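(* Let $f:\mathbb{R}^n\to\mathbb{R}$ be a convex function, and assume that $f\notin C^{1,1}_{\mathrm{loc}}(\mathbb{R}^n)$. Then the following conditions are equivalent: (1) For every $\varepsilon>0$ there exists a convex function $g\in C^{1,1}_{\mathrm{loc}}(\mathbb{R}^n)$ such that $|\{x\in\mathbb{R}^n:\ f(x)\neq g(x)\}|<\varepsilon$. (2) The function $f$ is essentially coercive. Moreover, if $f$ is essentially coercive, then for every $\varepsilon>0$ the function $g$ in (1) can be found so that, in addition, $g\ge f$.
   Context: $|E|$ denotes the Lebesgue measure of $E\subset\mathbb{R}^n$. $g\in C^{1,1}_{\mathrm{loc}}(\mathbb{R}^n)$ means that $g\in C^1(\mathbb{R}^n)$ and its derivative $Dg$ is locally Lipschitz continuous on $\mathbb{R}^n$. A convex function $f:\mathbb{R}^n\to\mathbb{R}$ is called essentially coercive if there exists a linear function $\ell:\mathbb{R}^n\to\mathbb{R}$ such that $\lim_{|x|\to\infty}(f(x)-\ell(x))=\infty$. *)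

theory Defs
  imports "HOL-Analysis.Analysis"
begin

text \<open>The derivative is a map into the space of bounded linear maps with the operator norm;
  its continuity and Lipschitz bounds refer to that norm.\<close>

definition C11_loc :: "('a::real_normed_vector \<Rightarrow> real) \<Rightarrow> bool" where
  "C11_loc g \<longleftrightarrow>
    (\<exists>Dg :: 'a \<Rightarrow> 'a \<Rightarrow>\<^sub>L real.
      (\<forall>x. (g has_derivative blinfun_apply (Dg x)) (at x)) \<and>
      continuous_on UNIV Dg \<and>
      (\<forall>x. \<exists>r>0. \<exists>L. L-lipschitz_on (ball x r) Dg))"

definition essentially_coercive :: "('a::real_normed_vector \<Rightarrow> real) \<Rightarrow> bool" where
  "essentially_coercive f \<longleftrightarrow>
    (\<exists>l :: 'a \<Rightarrow> real. linear l \<and> filterlim (\<lambda>x. f x - l x) at_top at_infinity)"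

end

theory Submission
  imports Defs
begin

text \<open>
  After subtracting an affine function, an essentially coercive \<open>f\<close> is nonnegative with bounded
  sublevel sets. Roll balls inside its epigraph: for a positive decreasing convex function \<open>\<rho>\<close> take
  the union of all balls in the epigraph whose radius lies between \<open>\<rho>\<close> of the height of the centre
  and \<open>1\<close>. Convexity of \<open>\<rho>\<close> makes this union convex; it is the epigraph of a function \<open>g \<ge> f\<close>
  that is locally \<open>C\<^sup>1\<^sup>,\<^sup>1\<close>, since its graph is touched from above by balls of locally bounded-below
  radius. Moreover \<open>g = f\<close> wherever the graph of \<open>f\<close> is touched by an admissible ball, so it
  suffices to choose \<open>\<rho>\<close> small enough on each of the countably many slabs \<open>k \<le> f < k + 1\<close>. That a
  bounded set is touched up to small measure follows from the maximisers of \<open>f z - C |z - c|\<^sup>2\<close>,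
  which are related to \<open>c\<close> by a nonexpansive map.

  Conversely, if \<open>f\<close> is not essentially coercive, the slopes of its affine minorants lie in a
  hyperplane, so \<open>f\<close> is affine along a fixed direction; then a convex \<open>g\<close> with
  \<open>|{f \<noteq> g}| < \<infinity>\<close> has to coincide with \<open>f\<close>.
\<close>

section \<open>Subgradients\<close>

definition subgradient :: "('a::real_inner \<Rightarrow> real) \<Rightarrow> 'a \<Rightarrow> 'a \<Rightarrow> bool" where
  "subgradient f x p \<longleftrightarrow> (\<forall>y. f x + p \<bullet> (y - x) \<le> f y)"

lemma subgradientD: "subgradient f x p \<Longrightarrow> f x + p \<bullet> (y - x) \<le> f y"
  by (simp add: subgradient_def)

lemma inner_sgn: "p \<bullet> sgn p = norm (p::'a::real_inner)"
  by (simp add: sgn_div_norm power2_norm_eq_inner[symmetric] power2_eq_square divide_simps)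

text \<open>A hyperplane separating the strict epigraph from \<open>(x, f x)\<close> supports the
  graph. It cannot be vertical, because \<open>f\<close> is finite on the whole space.\<close>

lemma subgradient_exists:
  fixes f :: "'a::euclidean_space \<Rightarrow> real"
  assumes f: "convex_on UNIV f"
  obtains p where "subgradient f x p"
proof -
  let ?S = "{z. f (fst z) < snd z}" and ?T = "{(x, f x)}"
  have "convex ?S"
  proof (rule convexI)
    fix z w :: "'a \<times> real" and u v :: real
    assume zw: "z \<in> ?S" "w \<in> ?S" and uv: "0 \<le> u" "0 \<le> v" "u + v = 1"
    have "f (u *\<^sub>R fst z + v *\<^sub>R fst w) \<le> u * f (fst z) + v * f (fst w)"
      using f uv by (simp add: convex_on_def)
    also have "\<dots> < u * snd z + v * snd w"
    proof (cases "u = 0")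
      case True
      then show ?thesis using zw uv by simp
    next
      case False
      then have "u * f (fst z) < u * snd z" using zw uv by simp
      moreover have "v * f (fst w) \<le> v * snd w" using zw uv by (simp add: mult_left_mono)
      ultimately show ?thesis by simp
    qed
    finally show "u *\<^sub>R z + v *\<^sub>R w \<in> ?S" by simp
  qed
  moreover have "(x, f x + 1) \<in> ?S" by simp
  then have "?S \<noteq> {}" by blast
  moreover have "?S \<inter> ?T = {}" by auto
  ultimately obtain a b where a: "a \<noteq> 0" "\<forall>z\<in>?S. a \<bullet> z \<le> b" "\<forall>z\<in>?T. b \<le> a \<bullet> z"
    using separating_hyperplane_sets[of ?S ?T] by auto
  obtain v \<alpha> where v\<alpha>: "a = (v, \<alpha>)" by (cases a)
  have *: "v \<bullet> y + \<alpha> * t \<le> v \<bullet> x + \<alpha> * f x" if "f y < t" for y t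
  proof -
    have "a \<bullet> (y, t) \<le> b" using a(2) that by simp
    also have "b \<le> a \<bullet> (x, f x)" using a(3) by simp
    finally show ?thesis by (simp add: v\<alpha>)
  qed
  have "\<alpha> \<le> 0" using *[of x "f x + 1"] by (simp add: algebra_simps)
  moreover have "\<alpha> \<noteq> 0"
  proof
    assume "\<alpha> = 0"
    then have "v \<bullet> (x + v) \<le> v \<bullet> x" using *[of "x + v" "f (x + v) + 1"] by simp
    then have "v \<bullet> v \<le> 0" by (simp add: inner_add_right)
    then have "v = 0" by (metis inner_ge_zero inner_eq_zero_iff order_antisym)
    then show False using a(1) v\<alpha> \<open>\<alpha> = 0\<close> by (simp add: zero_prod_def)
  qed
  ultimately have \<alpha>: "\<alpha> < 0" by simp
  have "subgradient f x ((- 1 / \<alpha>) *\<^sub>R v)"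
    unfolding subgradient_def
  proof
    fix y
    have "v \<bullet> (y - x) / (- \<alpha>) + f x \<le> t" if "f y < t" for t
    proof -
      have "v \<bullet> (y - x) \<le> (- \<alpha>) * (t - f x)"
        using *[OF that] by (simp add: inner_diff_right algebra_simps)
      then have "v \<bullet> (y - x) / (- \<alpha>) \<le> t - f x"
        using \<alpha> by (subst pos_divide_le_eq) (auto simp: mult.commute)
      then show ?thesis by simp
    qed
    then have "v \<bullet> (y - x) / (- \<alpha>) + f x \<le> f y" by (rule dense_ge)
    then show "f x + ((- 1 / \<alpha>) *\<^sub>R v) \<bullet> (y - x) \<le> f y" by simp
  qed
  then show ?thesis by (rule that)
qed

text \<open>A unit step in the direction of \<open>p\<close> raises \<open>f\<close> by at least
  \<open>norm p\<close>, so the size of \<open>f\<close> on a ball enlarged by 1 bounds all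
  slopes.\<close>

lemma subgradient_locally_bounded:
  fixes f :: "'a::euclidean_space \<Rightarrow> real"
  assumes f: "continuous_on UNIV f"
  obtains M where "M > 0" "\<And>x p. x \<in> cball a R \<Longrightarrow> subgradient f x p \<Longrightarrow> norm p \<le> M"
proof -
  have "compact (f ` cball a (R + 1))"
    by (intro compact_continuous_image continuous_on_subset[OF f]) auto
  then obtain K where K: "\<And>x. x \<in> cball a (R + 1) \<Longrightarrow> \<bar>f x\<bar> \<le> K"
    by (fastforce dest!: compact_imp_bounded simp: bounded_iff simp del: mem_cball)
  show ?thesis
  proof (rule that[of "2 * \<bar>K\<bar> + 1"])
    fix x p assume x: "x \<in> cball a R" and p: "subgradient f x p"
    have "dist a (x + sgn p) \<le> dist a x + dist x (x + sgn p)" by (rule dist_triangle)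
    also have "\<dots> \<le> R + 1" using x by (auto simp: dist_norm norm_sgn)
    finally have "\<bar>f (x + sgn p)\<bar> \<le> K" by (intro K) auto
    moreover have "\<bar>f x\<bar> \<le> K" using x by (intro K) auto
    moreover have "p \<bullet> sgn p = norm p" by (rule inner_sgn)
    ultimately show "norm p \<le> 2 * \<bar>K\<bar> + 1"
      using subgradientD[OF p, of "x + sgn p"] by simp
  qed simp
qed

text \<open>The comparison point \<open>z = x + u\<close> with \<open>u\<close> of length \<open>|x - y|\<close> in the direction of
  \<open>q - p\<close> lets the upper bound at \<open>x\<close> absorb the difference of the slopes.\<close>

lemma subgradient_dist_le:
  fixes f :: "'a::euclidean_space \<Rightarrow> real"
  assumes p: "subgradient f x p" and q: "subgradient f y q"
    and px: "\<And>d. norm d \<le> \<delta> \<Longrightarrow> f (x + d) \<le> f x + p \<bullet> d + A * (norm d)\<^sup>2"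
    and qy: "\<And>d. norm d \<le> \<delta> \<Longrightarrow> f (y + d) \<le> f y + q \<bullet> d + A * (norm d)\<^sup>2"
    and xy: "norm (x - y) \<le> \<delta>" "x \<noteq> y" and A: "A \<ge> 0"
  shows "norm (p - q) \<le> 2 * A * norm (x - y)"
proof -
  define u where "u = norm (x - y) *\<^sub>R sgn (q - p)"
  have nu: "norm u \<le> norm (x - y)" by (simp add: u_def norm_sgn)
  have "f y + q \<bullet> (x + u - y) \<le> f (x + u)" using q by (rule subgradientD)
  also have "\<dots> \<le> f x + p \<bullet> u + A * (norm u)\<^sup>2" using nu xy by (intro px) simp
  also have "A * (norm u)\<^sup>2 \<le> A * (norm (x - y))\<^sup>2"
    using A nu by (intro mult_left_mono power_mono) auto
  finally have 1: "f y + q \<bullet> (x - y) + (q - p) \<bullet> u \<le> f x + A * (norm (x - y))\<^sup>2"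
    by (simp add: inner_diff_left inner_add_right inner_diff_right)
  have 2: "f x \<le> f y + q \<bullet> (x - y) + A * (norm (x - y))\<^sup>2" using qy[of "x - y"] xy by simp
  have "(q - p) \<bullet> u = norm (x - y) * norm (p - q)"
    by (simp add: u_def inner_sgn norm_minus_commute)
  with 1 2 have "norm (x - y) * norm (p - q) \<le> norm (x - y) * (2 * A * norm (x - y))"
    by (simp add: power2_eq_square algebra_simps)
  then show ?thesis using xy by simp
qed

text \<open>The subgradient inequality is the matching lower estimate, so linearisation has a
  quadratic error and any selection of subgradients is the derivative;
  \<open>subgradient_dist_le\<close> makes it locally Lipschitz.\<close>

lemma C11_loc_if_quadratic_bound:
  fixes g :: "'a::euclidean_space \<Rightarrow> real"
  assumes g: "convex_on UNIV g"
    and quad: "\<And>x\<^sub>0. \<exists>\<delta>>0. \<exists>A\<ge>0. \<forall>x\<in>ball x\<^sub>0 \<delta>. \<forall>p d. subgradient g x p \<longrightarrow> norm d \<le> \<delta> \<longrightarrow>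
      g (x + d) \<le> g x + p \<bullet> d + A * (norm d)\<^sup>2"
  shows "C11_loc g"
proof -
  define p where "p x = (SOME p. subgradient g x p)" for x
  have p: "subgradient g x (p x)" for x
    unfolding p_def by (rule someI_ex) (meson subgradient_exists[OF g])
  have deriv: "(g has_derivative blinfun_inner_left (p x)) (at x)" for x
  proof -
    obtain \<delta> A where "\<delta> > 0" and q: "\<And>y p d. y \<in> ball x \<delta> \<Longrightarrow> subgradient g y p \<Longrightarrow> norm d \<le> \<delta>
        \<Longrightarrow> g (y + d) \<le> g y + p \<bullet> d + A * (norm d)\<^sup>2"
      using quad[of x] by blast
    show ?thesis
      unfolding has_derivative_at
    proof
      show "bounded_linear (blinfun_inner_left (p x))" by (rule blinfun.bounded_linear_right)
      show "(\<lambda>d. norm (g (x + d) - g x - blinfun_inner_left (p x) d) / norm d) \<midarrow>0\<rightarrow> 0"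
      proof (rule Lim_null_comparison)
        show "\<forall>\<^sub>F d in at 0. norm (norm (g (x + d) - g x - blinfun_inner_left (p x) d) / norm d) \<le> A * norm d"
          unfolding eventually_at
        proof (intro exI[of _ \<delta>] conjI ballI impI)
          fix d :: 'a assume d: "d \<noteq> 0 \<and> dist d 0 < \<delta>"
          have "g (x + d) \<le> g x + p x \<bullet> d + A * (norm d)\<^sup>2"
            using d \<open>\<delta> > 0\<close> by (intro q p) auto
          moreover have "g x + p x \<bullet> d \<le> g (x + d)" using subgradientD[OF p, of x "x + d"] by simp
          ultimately have "\<bar>g (x + d) - g x - p x \<bullet> d\<bar> \<le> A * (norm d)\<^sup>2" by linarith
          then show "norm (norm (g (x + d) - g x - blinfun_inner_left (p x) d) / norm d) \<le> A * norm d"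
            using d by (simp add: inner_commute divide_le_eq power2_eq_square mult.assoc)
        qed fact
        show "(\<lambda>d. A * norm d) \<midarrow>0\<rightarrow> 0" by (auto intro!: tendsto_eq_intros)
      qed
    qed
  qed
  have lip: "\<exists>r>0. \<exists>L. L-lipschitz_on (ball x r) (\<lambda>y. blinfun_inner_left (p y))" for x
  proof -
    obtain \<delta> A where "\<delta> > 0" "A \<ge> 0" and q: "\<And>y p d. y \<in> ball x \<delta> \<Longrightarrow> subgradient g y p \<Longrightarrow> norm d \<le> \<delta>
        \<Longrightarrow> g (y + d) \<le> g y + p \<bullet> d + A * (norm d)\<^sup>2"
      using quad[of x] by blast
    obtain K where K: "K > 0" "\<And>v::'a. norm (blinfun_inner_left v) \<le> norm v * K"
      using bounded_linear.pos_bounded[OF bounded_linear_blinfun_inner_left] by blast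
    \<comment> \<open>The radius is halved so that two points of the ball are at distance at most
      \<open>\<delta>\<close>.\<close>
    have "(2 * A * K)-lipschitz_on (ball x (\<delta> / 2)) (\<lambda>y. blinfun_inner_left (p y))"
    proof (rule lipschitz_onI)
      fix y z assume yz: "y \<in> ball x (\<delta> / 2)" "z \<in> ball x (\<delta> / 2)"
      have "dist y z \<le> \<delta>"
        using yz dist_triangle[of y z x] by (simp add: dist_commute)
      then have "norm (p y - p z) \<le> 2 * A * norm (y - z)"
        using yz \<open>\<delta> > 0\<close> \<open>A \<ge> 0\<close>
        by (cases "y = z") (auto intro!: subgradient_dist_le[OF p p, where \<delta> = \<delta>] q p simp: dist_norm)
      then have "norm (p y - p z) * K \<le> 2 * A * norm (y - z) * K"
        using K(1) by (intro mult_right_mono) auto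
      then have "norm (blinfun_inner_left (p y - p z)) \<le> 2 * A * norm (y - z) * K"
        using K(2)[of "p y - p z"] by linarith
      then show "dist (blinfun_inner_left (p y)) (blinfun_inner_left (p z)) \<le> 2 * A * K * dist y z"
        by (simp add: dist_norm linear_diff[OF bounded_linear.linear[OF bounded_linear_blinfun_inner_left], symmetric] mult_ac)
    qed (use \<open>A \<ge> 0\<close> K in simp)
    then show ?thesis using \<open>\<delta> > 0\<close> by (intro exI[of _ "\<delta> / 2"]) auto
  qed
  have "continuous_on UNIV (\<lambda>y. blinfun_inner_left (p y))"
    unfolding continuous_on_eq_continuous_at[OF open_UNIV]
  proof
    fix x
    obtain r L where "r > 0" "L-lipschitz_on (ball x r) (\<lambda>y. blinfun_inner_left (p y))"
      using lip by blast
    then show "continuous (at x) (\<lambda>y. blinfun_inner_left (p y))"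
      by (metis lipschitz_on_continuous_on centre_in_ball continuous_on_eq_continuous_at open_ball)
  qed
  then show ?thesis
    unfolding C11_loc_def using deriv lip by (intro exI[of _ "\<lambda>y. blinfun_inner_left (p y)"]) blast
qed

section \<open>Failure of coercivity\<close>

text \<open>If the slopes of affine minorants filled a ball about \<open>p\<close>, then
  \<open>f x - p \<bullet> x\<close> would grow linearly. Hence they lie in a hyperplane, and all
  subgradients have the same inner product \<open>a\<close> with its normal
  \<open>e\<close>.\<close>

lemma not_essentially_coercive_imp_affine_direction:
  fixes f :: "'a::euclidean_space \<Rightarrow> real"
  assumes f: "convex_on UNIV f" and "\<not> essentially_coercive f"
  obtains e a where "e \<noteq> 0" "\<And>x t. f (x + t *\<^sub>R e) = f x + t * a"
proof -
  \<comment> \<open>\<open>D\<close> is the effective domain of the convex conjugate of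
    \<open>f\<close>.\<close>
  define D where "D = {p. \<exists>c. \<forall>x. p \<bullet> x + c \<le> f x}"
  have D: "p \<in> D" if p: "subgradient f x p" for x p
    unfolding D_def
  proof (intro CollectI exI allI)
    show "p \<bullet> y + (f x - p \<bullet> x) \<le> f y" for y
      using subgradientD[OF p, of y] by (simp add: inner_diff_right)
  qed
  have "convex D"
  proof (rule convexI)
    fix p q and u v :: real assume pq: "p \<in> D" "q \<in> D" and uv: "0 \<le> u" "0 \<le> v" "u + v = 1"
    obtain c d where c: "\<And>x. p \<bullet> x + c \<le> f x" "\<And>x. q \<bullet> x + d \<le> f x"
      using pq by (auto simp: D_def)
    have "(u *\<^sub>R p + v *\<^sub>R q) \<bullet> x + (u * c + v * d) \<le> f x" for x
    proof -
      have "u * (p \<bullet> x + c) + v * (q \<bullet> x + d) \<le> u * f x + v * f x"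
        using c uv by (intro add_mono mult_left_mono)
      also have "\<dots> = f x" using uv by (simp add: distrib_right[symmetric])
      finally show ?thesis by (simp add: inner_add_left algebra_simps)
    qed
    then show "u *\<^sub>R p + v *\<^sub>R q \<in> D" by (auto simp: D_def)
  qed
  moreover have "interior D = {}"
  proof (rule ccontr)
    assume "interior D \<noteq> {}"
    then obtain p \<delta> where "\<delta> > 0" and ball: "cball p \<delta> \<subseteq> D"
      using mem_interior_cball by blast
    \<comment> \<open>It suffices to test the slopes \<open>p \<plusminus> \<delta> i\<close> with
      \<open>i\<close> a basis vector: choosing the sign according to \<open>i \<bullet> x\<close>
      produces \<open>\<bar>i \<bullet> x\<bar>\<close>, and these sum to a bound for the
      norm.\<close>
    define s where "s b = (if b then \<delta> else - \<delta>)" for b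
    have "\<exists>c. \<forall>x. (p + s b *\<^sub>R i) \<bullet> x + c \<le> f x" if "i \<in> Basis" for i :: 'a and b
    proof -
      have "p + s b *\<^sub>R i \<in> cball p \<delta>" using \<open>\<delta> > 0\<close> that by (auto simp: dist_norm s_def)
      then show ?thesis using ball by (auto simp: D_def)
    qed
    then obtain c where c: "\<And>i b x. i \<in> Basis \<Longrightarrow> (p + s b *\<^sub>R i) \<bullet> x + c i b \<le> f x" by metis
    define C where "C = (\<Sum>i\<in>Basis. \<bar>c i True\<bar> + \<bar>c i False\<bar>)"
    have C: "\<bar>c i b\<bar> \<le> C" if "i \<in> Basis" for i b
    proof -
      have "\<bar>c i b\<bar> \<le> \<bar>c i True\<bar> + \<bar>c i False\<bar>" by (cases b) auto
      also have "\<dots> \<le> C" unfolding C_def using that by (intro member_le_sum) auto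
      finally show ?thesis .
    qed
    have *: "\<delta> * \<bar>i \<bullet> x\<bar> \<le> f x - p \<bullet> x + C" if "i \<in> Basis" for i x
    proof -
      have "s (0 \<le> i \<bullet> x) * (i \<bullet> x) = \<delta> * \<bar>i \<bullet> x\<bar>" by (simp add: s_def)
      then show ?thesis
        using c[OF that, of "0 \<le> i \<bullet> x" x] C[OF that, of "0 \<le> i \<bullet> x"]
        by (simp add: inner_add_left abs_le_iff)
    qed
    have lower: "\<delta> / DIM('a) * norm x - C \<le> f x - p \<bullet> x" for x
    proof -
      have "\<delta> * norm x \<le> \<delta> * (\<Sum>i\<in>Basis. \<bar>x \<bullet> i\<bar>)"
        using \<open>\<delta> > 0\<close> by (intro mult_left_mono norm_le_l1) auto
      also have "\<dots> = (\<Sum>i\<in>Basis. \<delta> * \<bar>i \<bullet> x\<bar>)" by (simp add: sum_distrib_left inner_commute)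
      also have "\<dots> \<le> DIM('a) * (f x - p \<bullet> x + C)"
        using * by (intro sum_bounded_above) auto
      finally show ?thesis by (simp add: field_simps)
    qed
    have "filterlim (\<lambda>x. f x - p \<bullet> x) at_top at_infinity"
      unfolding filterlim_at_top eventually_at_infinity
    proof (intro allI exI impI)
      fix Z :: real and x :: 'a assume "(Z + C) * DIM('a) / \<delta> \<le> norm x"
      then have "Z \<le> \<delta> / DIM('a) * norm x - C" using \<open>\<delta> > 0\<close> by (simp add: field_simps)
      also note lower
      finally show "Z \<le> f x - p \<bullet> x" .
    qed
    then have "essentially_coercive f"
      unfolding essentially_coercive_def
      by (intro exI[of _ "\<lambda>x. p \<bullet> x"]) (simp add: linear_iff inner_add_right)
    then show False using assms(2) by contradiction
  qed
  ultimately obtain e a where "e \<noteq> 0" and e: "D \<subseteq> {x. e \<bullet> x = a}"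
    by (rule empty_interior_subset_hyperplane)
  show ?thesis
  proof (rule that[OF \<open>e \<noteq> 0\<close>])
    fix x t
    obtain p q where p: "subgradient f x p" and q: "subgradient f (x + t *\<^sub>R e) q"
      by (meson subgradient_exists[OF f])
    \<comment> \<open>The subgradient inequalities at the two points bound the increment of
      \<open>f\<close> from below and from above by the same \<open>t * a\<close>.\<close>
    have "p \<bullet> e = a" "q \<bullet> e = a" using e D[OF p] D[OF q] by (auto simp: inner_commute)
    then show "f (x + t *\<^sub>R e) = f x + t * a"
      using subgradientD[OF p, of "x + t *\<^sub>R e"] subgradientD[OF q, of x] by simp
  qed
qed

section \<open>Functions that are affine along a direction\<close>

text \<open>If \<open>g - f\<close> is convex along the direction \<open>e\<close> and does not vanish at \<open>x\<close>, it cannot vanish at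
  all four points \<open>x \<plusminus> t e\<close>, \<open>x \<plusminus> 2 t e\<close>. So a ball on which \<open>f \<noteq> g\<close> is covered by four
  translates of the part of \<open>{x. f x \<noteq> g x}\<close> far from the origin, whose measure is small.\<close>

lemma eq_if_affine_direction:
  fixes f g :: "'a::euclidean_space \<Rightarrow> real"
  assumes f: "continuous_on UNIV f" and g: "convex_on UNIV g"
    and "e \<noteq> 0" and aff: "\<And>x t. f (x + t *\<^sub>R e) = f x + t * a"
    and fin: "emeasure lebesgue {x. f x \<noteq> g x} < \<infinity>"
  shows "f = g"
proof (rule ccontr)
  define N where "N = {x. f x \<noteq> g x}"
  assume "f \<noteq> g"
  then obtain x\<^sub>0 where "x\<^sub>0 \<in> N" by (auto simp: N_def)
  have "continuous_on UNIV g" using g by (intro convex_on_continuous) auto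
  then have "open N" unfolding N_def using f by (intro open_Collect_neq)
  then obtain \<rho> where \<rho>: "\<rho> > 0" "ball x\<^sub>0 \<rho> \<subseteq> N" using \<open>x\<^sub>0 \<in> N\<close> open_contains_ball by blast
  define m where "m = measure lebesgue (ball x\<^sub>0 \<rho>)"
  have "m > 0" unfolding m_def using content_ball_pos[OF \<rho>(1)] by simp
  \<comment> \<open>Since \<open>N\<close> has finite measure, its part outside a large ball has
    measure below \<open>m / 4\<close>, too little for four translates to cover a ball of measure
    \<open>m\<close>.\<close>
  let ?F = "\<lambda>k::nat. N - ball 0 (real k)"
  have sets: "N - ball 0 R \<in> sets lebesgue" for R
    using \<open>open N\<close> by (metis borel_open open_ball sets.Diff sets_completionI_sets sets_lborel)
  have fN: "emeasure lebesgue (N - ball 0 R) < \<infinity>" for R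
  proof -
    have "emeasure lebesgue (N - ball 0 R) \<le> emeasure lebesgue N"
      using \<open>open N\<close> by (intro emeasure_mono) auto
    then show ?thesis using fin unfolding N_def by order
  qed
  have "(\<lambda>k. emeasure lebesgue (?F k)) \<longlonglongrightarrow> emeasure lebesgue (\<Inter>k. ?F k)"
    using sets fN by (intro Lim_emeasure_decseq) (auto simp: decseq_def less_top[symmetric])
  moreover have "(\<Inter>k. ?F k) = {}"
  proof (rule equals0I)
    fix x assume x: "x \<in> (\<Inter>k. ?F k)"
    obtain k where "norm x < real k" using reals_Archimedean2 by blast
    moreover have "x \<in> ?F k" using x by blast
    ultimately show False by simp
  qed
  ultimately have "(\<lambda>k. emeasure lebesgue (?F k)) \<longlonglongrightarrow> 0"
    by (simp only: emeasure_empty)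
  moreover have "(0::ennreal) < ennreal (m / 4)" using \<open>m > 0\<close> by simp
  ultimately have "\<forall>\<^sub>F k in sequentially. emeasure lebesgue (?F k) < ennreal (m / 4)"
    by (rule order_tendstoD(2))
  then obtain k where k: "emeasure lebesgue (?F k) < ennreal (m / 4)"
    using eventually_happens by fastforce
  have Fk: "?F k \<in> lmeasurable" using sets fN by (intro fmeasurableI) auto
  have mk: "measure lebesgue (?F k) < m / 4"
    using k Fk \<open>m > 0\<close> by (simp add: emeasure_eq_measure2 ennreal_less_iff)
  \<comment> \<open>A shift of a point of \<open>ball x\<^sub>0 \<rho>\<close> along
    \<open>e\<close> by a parameter of size at least \<open>t\<close> leaves
    \<open>ball 0 (real k)\<close>.\<close>
  define t where "t = (norm x\<^sub>0 + \<rho> + real k) / norm e"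
  have t: "t * norm e = norm x\<^sub>0 + \<rho> + real k" using \<open>e \<noteq> 0\<close> by (simp add: t_def)
  have tpos: "t > 0" using \<open>e \<noteq> 0\<close> \<rho> by (simp add: t_def add_nonneg_pos add_pos_nonneg)
  let ?s = "{t, - t, 2 * t, - 2 * t}"
  have "ball x\<^sub>0 \<rho> \<subseteq> (\<Union>s\<in>?s. (+) (- s *\<^sub>R e) ` ?F k)"
  proof
    fix x assume x: "x \<in> ball x\<^sub>0 \<rho>"
    have far: "x + s *\<^sub>R e \<notin> ball 0 (real k)" if "s \<in> ?s" for s
    proof -
      have "t * norm e \<le> \<bar>s\<bar> * norm e" using that tpos by (intro mult_right_mono) auto
      also have "\<dots> = norm ((x + s *\<^sub>R e) - x)" by simp
      also have "\<dots> \<le> norm (x + s *\<^sub>R e) + norm x" by (rule norm_triangle_ineq4)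
      also have "norm x \<le> norm x\<^sub>0 + \<rho>"
        using x norm_triangle_ineq2[of x x\<^sub>0] by (simp add: dist_norm norm_minus_commute)
      finally show ?thesis using t by simp
    qed
    have "\<exists>s\<in>?s. x + s *\<^sub>R e \<in> N"
    proof (rule ccontr)
      assume "\<not> ?thesis"
      then have eq: "g (x + s *\<^sub>R e) = f x + s * a" if "s \<in> ?s" for s
        using that aff by (auto simp: N_def)
      \<comment> \<open>The midpoint \<open>x\<close> of \<open>x \<plusminus> t e\<close> gives
        \<open>g x \<le> f x\<close>; below, the midpoint \<open>x + t e\<close> of \<open>x\<close>
        and \<open>x + 2 t e\<close> gives the converse.\<close>
      have "g ((1 - 1/2) *\<^sub>R (x + t *\<^sub>R e) + (1/2) *\<^sub>R (x + (- t) *\<^sub>R e))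
          \<le> (1 - 1/2) * g (x + t *\<^sub>R e) + 1/2 * g (x + (- t) *\<^sub>R e)"
        by (rule convex_onD[OF g]) auto
      moreover have "(1 - 1/2) *\<^sub>R (x + t *\<^sub>R e) + (1/2) *\<^sub>R (x + (- t) *\<^sub>R e) = x"
        by (simp add: algebra_simps scaleR_left_distrib[symmetric])
      ultimately have 1: "g x \<le> f x" using eq[of t] eq[of "- t"]
        by (simp add: add_divide_distrib diff_divide_distrib)
      have "g ((1 - 1/2) *\<^sub>R x + (1/2) *\<^sub>R (x + (2 * t) *\<^sub>R e))
          \<le> (1 - 1/2) * g x + 1/2 * g (x + (2 * t) *\<^sub>R e)"
        by (rule convex_onD[OF g]) auto
      moreover have "(1 - 1/2) *\<^sub>R x + (1/2) *\<^sub>R (x + (2 * t) *\<^sub>R e) = x + t *\<^sub>R e"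
        by (simp add: algebra_simps scaleR_left_distrib[symmetric])
      ultimately have "f x \<le> g x" using eq[of t] eq[of "2 * t"]
        by (simp add: add_divide_distrib)
      moreover have "f x \<noteq> g x" using x \<rho> by (auto simp: N_def)
      ultimately show False using 1 by simp
    qed
    then obtain s where s: "s \<in> ?s" "x + s *\<^sub>R e \<in> ?F k" using far by blast
    moreover have "x = - s *\<^sub>R e + (x + s *\<^sub>R e)" by simp
    ultimately show "x \<in> (\<Union>s\<in>?s. (+) (- s *\<^sub>R e) ` ?F k)" by blast
  qed
  then have "m \<le> measure lebesgue (\<Union>s\<in>?s. (+) (- s *\<^sub>R e) ` ?F k)"
    unfolding m_def using Fk
    by (intro measure_mono_fmeasurable fmeasurable.finite_UN measurable_translation) auto
  also have "\<dots> \<le> (\<Sum>s\<in>?s. measure lebesgue ((+) (- s *\<^sub>R e) ` ?F k))"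
    using Fk by (intro measure_UNION_le measurable_translation fmeasurableD) auto
  also have "\<dots> = (\<Sum>s\<in>?s. measure lebesgue (?F k))"
    by (simp only: measure_translation)
  also have "\<dots> = 4 * measure lebesgue (?F k)" using tpos by simp
  finally show False using mk by simp
qed

section \<open>Points touched from above by a paraboloid\<close>

text \<open>The constant must be exactly 1, which a Vitali covering achieves: \<open>F\<close> sends
  the part of \<open>S\<close> in a ball into a ball of the same radius about the image of its
  centre. The disjoint balls lie in an open set barely larger than \<open>S\<close>, and the null
  set that they miss has a null image.\<close>

lemma measure_le_if_nonexpansive:
  fixes F :: "'a::euclidean_space \<Rightarrow> 'a"
  assumes S: "S \<in> lmeasurable" and T: "T \<in> lmeasurable" "T \<subseteq> F ` S"
    and F: "\<And>x y. x \<in> S \<Longrightarrow> y \<in> S \<Longrightarrow> dist (F x) (F y) \<le> dist x y"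
  shows "measure lebesgue T \<le> measure lebesgue S"
proof (rule field_le_epsilon)
  fix \<epsilon> :: real assume "\<epsilon> > 0"
  obtain U where U: "open U" "S \<subseteq> U" "U - S \<in> lmeasurable" "emeasure lebesgue (U - S) < ennreal \<epsilon>"
    using sets_lebesgue_outer_open[OF fmeasurableD[OF S] \<open>\<epsilon> > 0\<close>] by blast
  have Um: "U \<in> lmeasurable" using fmeasurable.Un[OF S U(3)] U(2) by (simp add: Un_absorb1)
  have "measure lebesgue U = measure lebesgue S + measure lebesgue (U - S)"
    using S Um U(2) by (simp add: measurable_measure_Diff)
  moreover have "measure lebesgue (U - S) < \<epsilon>"
    using U(3,4) \<open>\<epsilon> > 0\<close> by (simp add: emeasure_eq_measure2 ennreal_less_iff)
  ultimately have mU: "measure lebesgue U \<le> measure lebesgue S + \<epsilon>" by simp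
  \<comment> \<open>Centres lie in \<open>S\<close>, where \<open>F\<close> is known to be
    nonexpansive; balls stay in \<open>U\<close>, so that disjoint ones have total measure at most
    that of \<open>U\<close>.\<close>
  define K where "K = {(x, r). x \<in> S \<and> 0 < r \<and> ball x r \<subseteq> U}"
  have "\<exists>i. i \<in> K \<and> x \<in> ball (fst i) (snd i) \<and> snd i < d" if x: "x \<in> S" "0 < d" for x d
  proof -
    obtain r where "r > 0" "ball x r \<subseteq> U" using U x open_contains_ball by blast
    then have "(x, min r (d / 2)) \<in> K \<and> x \<in> ball x (min r (d / 2)) \<and> min r (d / 2) < d"
      using x by (auto simp: K_def)
    then show ?thesis by (metis fst_conv snd_conv)
  qed
  then obtain C where C: "countable C" "C \<subseteq> K"
     "pairwise (\<lambda>i j. disjnt (ball (fst i) (snd i)) (ball (fst j) (snd j))) C"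
     "negligible (S - (\<Union>i\<in>C. ball (fst i) (snd i)))"
    by (rule Vitali_covering_theorem_balls[of S K fst snd])
  let ?B = "\<lambda>i. ball (fst i) (snd i)" and ?B' = "\<lambda>i. ball (F (fst i)) (snd i)"
  let ?Z = "S - (\<Union>i\<in>C. ?B i)"
  have "negligible (F ` ?Z)"
    using C(4)
  proof (rule negligible_locally_Lipschitz_image[OF order_refl])
    fix x assume "x \<in> ?Z"
    then show "\<exists>T B. open T \<and> x \<in> T \<and> (\<forall>y\<in>?Z \<inter> T. norm (F y - F x) \<le> B * norm (y - x))"
      using F by (intro exI[of _ UNIV] exI[of _ 1]) (auto simp: dist_norm)
  qed
  have "T \<subseteq> F ` ?Z \<union> (\<Union>i\<in>C. ?B' i)"
  proof
    fix y assume "y \<in> T"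
    then obtain x where x: "x \<in> S" "y = F x" using T by blast
    show "y \<in> F ` ?Z \<union> (\<Union>i\<in>C. ?B' i)"
    proof (cases "x \<in> ?Z")
      case False
      then obtain i where i: "i \<in> C" "x \<in> ?B i" using x by blast
      then have "fst i \<in> S" using C(2) by (auto simp: K_def)
      then have "y \<in> ?B' i" using F[of "fst i" x] x i by auto
      then show ?thesis using i by blast
    qed (use x in blast)
  qed
  then have *: "T - F ` ?Z \<subseteq> (\<Union>i\<in>C. ?B' i)" by blast
  have fin: "measure lebesgue (\<Union>i\<in>C'. ?B' i) \<le> measure lebesgue U" if C': "C' \<subseteq> C" "finite C'" for C'
  proof -
    have "measure lebesgue (\<Union>i\<in>C'. ?B' i) \<le> (\<Sum>i\<in>C'. measure lebesgue (?B' i))"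
      using C' by (intro measure_UNION_le) auto
    also have "\<dots> = (\<Sum>i\<in>C'. measure lebesgue (?B i))"
    proof (rule sum.cong)
      fix i assume "i \<in> C'"
      then have "snd i > 0" using C(2) C' by (auto simp: K_def)
      then show "measure lebesgue (?B' i) = measure lebesgue (?B i)" by (simp add: content_ball)
    qed simp
    also have "\<dots> = measure lebesgue (\<Union>i\<in>C'. ?B i)"
      using C' C(3) by (intro measure_UNION'[symmetric]) (auto intro: pairwise_subset)
    also have "\<dots> \<le> measure lebesgue U"
      using C(2) C' Um by (intro measure_mono_fmeasurable UN_least) (fastforce simp: K_def)+
    finally show ?thesis .
  qed
  have "measure lebesgue T = measure lebesgue (T - F ` ?Z)"
    using \<open>negligible (F ` ?Z)\<close> T by (simp add: measure_Diff_null_set negligible_iff_null_sets)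
  also have "\<dots> \<le> measure lebesgue (\<Union>i\<in>C. ?B' i)"
    using * T negligible_imp_sets[OF \<open>negligible (F ` ?Z)\<close>] C(1)
    by (intro measure_mono_fmeasurable fmeasurable_UN_bound[OF C(1) _ fin] sets.Diff) auto
  also have "\<dots> \<le> measure lebesgue U"
    by (intro measure_UN_bound[OF C(1) _ fin]) auto
  finally show "measure lebesgue T \<le> measure lebesgue S + \<epsilon>" using mU by simp
qed

text \<open>The slope \<open>p\<close> is then the gradient of \<open>f\<close> at \<open>x\<close>.
  The range of \<open>d\<close> is the unit ball for every \<open>C\<close>, so that only the
  opening of the paraboloid varies.\<close>

definition touched_above :: "('a::real_inner \<Rightarrow> real) \<Rightarrow> real \<Rightarrow> 'a \<Rightarrow> 'a \<Rightarrow> bool" where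
  "touched_above f C x p \<longleftrightarrow>
    subgradient f x p \<and> (\<forall>d. norm d \<le> 1 \<longrightarrow> f (x + d) \<le> f x + p \<bullet> d + C * (norm d)\<^sup>2)"

text \<open>Baillon--Haddad argument: slopes at touched points are co-coercive, so \<open>x - p / (2C)\<close>
  depends on \<open>x\<close> in a nonexpansive way.\<close>

lemma touched_above_nonexpansive:
  fixes f :: "'a::euclidean_space \<Rightarrow> real"
  assumes x: "touched_above f C x p" and y: "touched_above f C y q"
    and M: "norm p \<le> M" "norm q \<le> M" "M \<le> C" and C: "C > 0"
  shows "dist (x - (1 / (2 * C)) *\<^sub>R p) (y - (1 / (2 * C)) *\<^sub>R q) \<le> dist x y"
proof -
  have *: "f y - f x + q \<bullet> (x - y) \<le> - (norm (p - q))\<^sup>2 / (4 * C)"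
    if x: "touched_above f C x p" and y: "touched_above f C y q"
    and M: "norm p \<le> M" "norm q \<le> M" for x y p q
  proof -
    \<comment> \<open>This maximises \<open>(q - p) \<bullet> d - C * (norm d)\<^sup>2\<close>, the
      varying part of the gap between the supporting plane at \<open>y\<close> and the paraboloid at
      \<open>x\<close>; \<open>M \<le> C\<close> keeps it in the unit ball.\<close>
    define d where "d = (1 / (2 * C)) *\<^sub>R (q - p)"
    have "norm (q - p) \<le> 2 * C" using M \<open>M \<le> C\<close> norm_triangle_ineq4[of q p] by linarith
    then have d: "norm d \<le> 1" using C by (simp add: d_def)
    have "f y + q \<bullet> (x + d - y) \<le> f (x + d)" using y by (simp add: touched_above_def subgradientD)
    also have "\<dots> \<le> f x + p \<bullet> d + C * (norm d)\<^sup>2" using x d by (simp add: touched_above_def)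
    finally have "f y - f x + q \<bullet> (x - y) \<le> - ((q - p) \<bullet> d) + C * (norm d)\<^sup>2"
      by (simp add: inner_diff_left inner_add_right inner_diff_right)
    also have "(q - p) \<bullet> d = (norm (p - q))\<^sup>2 / (2 * C)"
      by (simp add: d_def power2_norm_eq_inner[symmetric] norm_minus_commute)
    also have "C * (norm d)\<^sup>2 = (norm (p - q))\<^sup>2 / (4 * C)"
      using C by (simp add: d_def norm_minus_commute power_mult_distrib power_divide power2_eq_square)
    finally show ?thesis by (simp add: field_simps)
  qed
  have "q \<bullet> (x - y) + p \<bullet> (y - x) \<le> - (norm (p - q))\<^sup>2 / (4 * C) - (norm (p - q))\<^sup>2 / (4 * C)"
    using *[OF x y M(1,2)] *[OF y x M(2,1)] by (simp add: norm_minus_commute)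
  then have coco: "(norm (p - q))\<^sup>2 / (2 * C) \<le> (x - y) \<bullet> (p - q)"
    using C by (simp add: inner_diff_left inner_diff_right inner_commute field_simps)
  define k where "k = 1 / (2 * C)"
  have k: "k > 0" "(norm (p - q))\<^sup>2 * k \<le> (x - y) \<bullet> (p - q)" using C coco by (auto simp: k_def)
  have "(x - y) - k *\<^sub>R (p - q) = (x - k *\<^sub>R p) - (y - k *\<^sub>R q)" by (simp add: algebra_simps)
  then have "(dist (x - k *\<^sub>R p) (y - k *\<^sub>R q))\<^sup>2 = (norm ((x - y) - k *\<^sub>R (p - q)))\<^sup>2"
    by (simp only: dist_norm)
  also have "\<dots> = (norm (x - y))\<^sup>2 - 2 * k * ((x - y) \<bullet> (p - q)) + k\<^sup>2 * (norm (p - q))\<^sup>2"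
    unfolding power2_norm_eq_inner
    by (simp add: inner_diff_left inner_diff_right inner_commute algebra_simps power2_eq_square)
  also have "\<dots> \<le> (norm (x - y))\<^sup>2"
  proof -
    have "k * ((norm (p - q))\<^sup>2 * k) \<le> k * ((x - y) \<bullet> (p - q))"
      using k by (intro mult_left_mono) auto
    moreover have "0 \<le> k * ((norm (p - q))\<^sup>2 * k)" using k by simp
    ultimately have "k * ((norm (p - q))\<^sup>2 * k) \<le> 2 * (k * ((x - y) \<bullet> (p - q)))" by linarith
    then show ?thesis by (simp add: power2_eq_square mult_ac)
  qed
  finally show ?thesis unfolding k_def by (simp add: dist_norm power2_le_iff_abs_le)
qed

text \<open>For \<open>c\<close> in a slightly smaller ball, a maximiser \<open>y\<close> of \<open>f z - C |z - c|\<^sup>2\<close> is touched from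
  above with slope \<open>2 C (y - c)\<close>; by the previous lemma the map from \<open>y\<close> to \<open>c\<close> is
  nonexpansive, and it is onto the smaller ball.\<close>

lemma touched_above_large:
  fixes f :: "'a::euclidean_space \<Rightarrow> real"
  assumes f: "convex_on UNIV f" and "R > 0" "\<epsilon> > 0"
  obtains C S where "C > 0" "compact S" "S \<subseteq> cball 0 R"
    "\<And>x. x \<in> S \<Longrightarrow> \<exists>p. touched_above f C x p" "measure lebesgue (cball 0 R - S) < \<epsilon>"
proof -
  have cont: "continuous_on UNIV f" using f by (intro convex_on_continuous) auto
  obtain M where "M > 0" and M: "\<And>x p. x \<in> cball 0 (R + 1) \<Longrightarrow> subgradient f x p \<Longrightarrow> norm p \<le> M"
    using subgradient_locally_bounded[OF cont, of 0 "R + 1"] by blast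
  let ?v = "unit_ball_vol (DIM('a))"
  \<comment> \<open>The shell between the radii \<open>R - s\<close> and \<open>R\<close> has small
    volume when \<open>s\<close> is small.\<close>
  have "((\<lambda>s. ?v * R ^ DIM('a) - ?v * (R - s) ^ DIM('a)) \<longlongrightarrow> ?v * R ^ DIM('a) - ?v * (R - 0) ^ DIM('a))
      (at_right 0)"
    by (intro tendsto_intros)
  then have "\<forall>\<^sub>F s in at_right 0. ?v * R ^ DIM('a) - ?v * (R - s) ^ DIM('a) < \<epsilon>"
    using \<open>\<epsilon> > 0\<close> by (intro order_tendstoD(2)) auto
  moreover have "\<forall>\<^sub>F s in at_right 0. s \<in> {0<..<min 1 R}"
    using \<open>R > 0\<close> by (intro eventually_at_right_real) auto
  ultimately have "\<forall>\<^sub>F s in at_right 0. ?v * R ^ DIM('a) - ?v * (R - s) ^ DIM('a) < \<epsilon> \<and> s \<in> {0<..<min 1 R}"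
    by (rule eventually_conj)
  then obtain s where s: "?v * R ^ DIM('a) - ?v * (R - s) ^ DIM('a) < \<epsilon>" "0 < s" "s < 1" "s < R"
    using eventually_happens[of _ "at_right (0::real)"] by auto
  \<comment> \<open>With this opening a maximiser lies within \<open>s\<close> of \<open>c\<close>,
    and \<open>s < 1\<close> gives \<open>M \<le> C\<close>, as
    \<open>touched_above_nonexpansive\<close> demands.\<close>
  define C where "C = M / s"
  have C: "C > 0" "M \<le> C" "M = C * s" using s \<open>M > 0\<close> by (auto simp: C_def field_simps)
  \<comment> \<open>Pairs of a maximiser and its parameter. Maximality on the radius
    \<open>R + 1\<close> leaves room for unit displacements; it is a closed condition, which makes
    \<open>S\<close> compact and hence measurable.\<close>
  define K where "K = (cball 0 R \<times> cball 0 (R - s)) \<inter> (\<Inter>z\<in>cball 0 (R + 1).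
    {w. f z - C * (norm (z - snd w))\<^sup>2 \<le> f (fst w) - C * (norm (fst w - snd w))\<^sup>2})"
  have "continuous_on UNIV (\<lambda>w::'a \<times> 'a. f (fst w))"
    by (rule continuous_on_compose2[OF cont]) (auto intro: continuous_intros)
  then have "compact K"
    unfolding K_def
    by (intro compact_Int_closed compact_Times compact_cball closed_INT ballI closed_Collect_le continuous_intros)
  define S where "S = fst ` K"
  have "compact S" unfolding S_def
    using \<open>compact K\<close> by (intro compact_continuous_image continuous_intros)
  have touch: "touched_above f C y ((2 * C) *\<^sub>R (y - c))" if "(y, c) \<in> K" for y c
  proof -
    have y: "norm y \<le> R"
      and max: "\<And>z. z \<in> cball 0 (R + 1) \<Longrightarrow> f z - C * (norm (z - c))\<^sup>2 \<le> f y - C * (norm (y - c))\<^sup>2"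
      using that by (auto simp: K_def)
    have up: "f (y + d) \<le> f y + ((2 * C) *\<^sub>R (y - c)) \<bullet> d + C * (norm d)\<^sup>2" if "norm d \<le> 1" for d
    proof -
      have "f (y + d) - C * (norm (y + d - c))\<^sup>2 \<le> f y - C * (norm (y - c))\<^sup>2"
        using y that norm_triangle_ineq[of y d] by (intro max) auto
      moreover have "(norm (y + d - c))\<^sup>2 = (norm (y - c))\<^sup>2 + 2 * ((y - c) \<bullet> d) + (norm d)\<^sup>2"
        unfolding power2_norm_eq_inner by (simp add: inner_diff_left inner_diff_right inner_add_left
            inner_add_right inner_commute algebra_simps)
      then have "C * (norm (y + d - c))\<^sup>2
          = C * (norm (y - c))\<^sup>2 + ((2 * C) *\<^sub>R (y - c)) \<bullet> d + C * (norm d)\<^sup>2"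
        by (simp only: inner_scaleR_left distrib_left mult_ac)
      ultimately show ?thesis by linarith
    qed
    obtain p where p: "subgradient f y p" by (meson subgradient_exists[OF f])
    \<comment> \<open>Every subgradient at \<open>y\<close> has the slope of the paraboloid: testing
      the discrepancy \<open>q\<close> along its own direction with step \<open>t\<close> gives
      \<open>norm q \<le> C * t\<close>, and \<open>t\<close> is arbitrarily small.\<close>
    define q where "q = p - (2 * C) *\<^sub>R (y - c)"
    have nq: "norm q \<le> C * t" if t: "0 < t" "t < 1" for t
    proof -
      have nt: "norm (t *\<^sub>R sgn q) \<le> t" using t by (simp add: norm_sgn)
      have "f y + p \<bullet> (t *\<^sub>R sgn q) \<le> f (y + t *\<^sub>R sgn q)" using subgradientD[OF p, of "y + t *\<^sub>R sgn q"] by simp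
      also have "\<dots> \<le> f y + ((2 * C) *\<^sub>R (y - c)) \<bullet> (t *\<^sub>R sgn q) + C * (norm (t *\<^sub>R sgn q))\<^sup>2"
        using nt t by (intro up) linarith
      finally have "(p - (2 * C) *\<^sub>R (y - c)) \<bullet> (t *\<^sub>R sgn q) \<le> C * (norm (t *\<^sub>R sgn q))\<^sup>2"
        unfolding inner_diff_left[of p] by linarith
      then have "q \<bullet> (t *\<^sub>R sgn q) \<le> C * (norm (t *\<^sub>R sgn q))\<^sup>2" by (simp only: q_def)
      also have "\<dots> \<le> C * t\<^sup>2" using C nt by (intro mult_left_mono power_mono) auto
      finally show ?thesis using t by (simp add: inner_sgn power2_eq_square)
    qed
    have "norm q / C \<le> t" if "0 < t" "t < 1" for t
      using nq[OF that] C by (simp add: pos_divide_le_eq mult.commute)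
    then have "norm q / C \<le> 0" by (intro dense_ge_bounded[of 0 1]) auto
    then have "q = 0" using C by (simp add: divide_le_0_iff)
    then show ?thesis using p up by (simp add: touched_above_def q_def)
  qed
  have nonexp: "dist c c' \<le> dist y y'" if "(y, c) \<in> K" "(y', c') \<in> K" for y c y' c'
  proof -
    have "norm ((2 * C) *\<^sub>R (y - c)) \<le> M" "norm ((2 * C) *\<^sub>R (y' - c')) \<le> M"
      using touch that by (auto simp: touched_above_def K_def simp del: norm_scaleR intro!: M)
    from touched_above_nonexpansive[OF touch[OF that(1)] touch[OF that(2)] this C(2,1)]
    show ?thesis using C by simp
  qed
  define F where "F y = (SOME c. (y, c) \<in> K)" for y
  have F: "(y, F y) \<in> K" if "y \<in> S" for y
    unfolding F_def using that by (auto simp: S_def intro: someI)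
  have "cball 0 (R - s) \<subseteq> F ` S"
  proof
    fix c :: 'a assume c: "c \<in> cball 0 (R - s)"
    have sup: "continuous_on (cball 0 (R + 1)) (\<lambda>z. f z - C * (norm (z - c))\<^sup>2)"
      by (intro continuous_intros continuous_on_subset[OF cont]) auto
    then obtain y where y: "y \<in> cball 0 (R + 1)"
      "\<And>z. z \<in> cball 0 (R + 1) \<Longrightarrow> f z - C * (norm (z - c))\<^sup>2 \<le> f y - C * (norm (y - c))\<^sup>2"
      using continuous_attains_sup[OF compact_cball _ sup] \<open>R > 0\<close> by auto
    obtain p where p: "subgradient f y p" by (meson subgradient_exists[OF f])
    \<comment> \<open>Comparing the values at \<open>y\<close> and \<open>c\<close> through the
      slope bound \<open>M = C * s\<close> confines \<open>y\<close> to distance \<open>s\<close>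
      from \<open>c\<close>.\<close>
    have "C * (norm (y - c))\<^sup>2 \<le> f y - f c" using y(2)[of c] c \<open>0 < s\<close> by simp
    also have "\<dots> \<le> p \<bullet> (y - c)" using subgradientD[OF p, of c] by (simp add: inner_diff_right)
    also have "\<dots> \<le> norm p * norm (y - c)" by (rule norm_cauchy_schwarz)
    also have "\<dots> \<le> C * s * norm (y - c)" using M[OF y(1) p] C by (intro mult_right_mono) auto
    finally have "norm (y - c) \<le> s" using C \<open>0 < s\<close>
      by (cases "y = c") (auto simp: power2_eq_square)
    then have "norm y \<le> R" using c norm_triangle_ineq2[of y c] by simp
    then have "(y, c) \<in> K" using c y by (auto simp: K_def)
    then have "y \<in> S" by (force simp: S_def)
    \<comment> \<open>Nonexpansiveness with equal first components shows that a maximiser determines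
      its parameter.\<close>
    moreover have "c = F y" using nonexp[OF \<open>(y, c) \<in> K\<close> F[OF \<open>y \<in> S\<close>]] by simp
    ultimately show "c \<in> F ` S" by blast
  qed
  then have "measure lebesgue (cball 0 (R - s) :: 'a set) \<le> measure lebesgue S"
    using nonexp F \<open>compact S\<close> by (intro measure_le_if_nonexpansive[where F = F]) (auto simp: lmeasurable_compact)
  moreover have SR: "S \<subseteq> cball 0 R" by (auto simp: S_def K_def)
  then have "measure lebesgue (cball 0 R - S) = measure lebesgue (cball 0 R :: 'a set) - measure lebesgue S"
    using \<open>compact S\<close> by (intro measurable_measure_Diff) (auto simp: lmeasurable_compact fmeasurableD)
  ultimately have "measure lebesgue (cball 0 R - S) < \<epsilon>"
    using s \<open>R > 0\<close> by (simp add: content_cball)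
  moreover have "\<exists>p. touched_above f C x p" if x: "x \<in> S" for x
  proof -
    obtain w where "w \<in> K" "x = fst w" using x unfolding S_def by blast
    then have "(x, snd w) \<in> K" by simp
    then show ?thesis using touch by blast
  qed
  ultimately show ?thesis using that[OF C(1) \<open>compact S\<close> SR] by blast
qed

section \<open>Rolling balls in the epigraph\<close>

text \<open>A weighted series of hinges \<open>max 0 (k + 1 - h)\<close>, each convex and
  decreasing. At \<open>h = j\<close> the hinges with \<open>k < j\<close> vanish and the others
  contribute at most \<open>r j\<close> times geometric weights; hinges far out keep the sum
  positive.\<close>

lemma positive_convex_minorant:
  fixes r :: "nat \<Rightarrow> real"
  assumes r: "\<And>k. r k > 0"
  obtains \<rho> :: "real \<Rightarrow> real" where "convex_on UNIV \<rho>" "antimono \<rho>" "\<And>h. \<rho> h > 0"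
    "\<And>k. \<rho> (real k) \<le> r k"
proof -
  define m where "m k = Min (r ` {..k})" for k
  have m: "m k > 0" "j \<le> k \<Longrightarrow> m k \<le> r j" for j k
    using r by (auto simp: m_def)
  \<comment> \<open>The divisor cancels the largest size of the hinge on nonnegative heights, and
    the running minimum \<open>m k\<close> is below \<open>r j\<close> for every
    \<open>j \<le> k\<close>.\<close>
  define a where "a k = m k / real (Suc k)" for k
  define T where "T h k = a k * max 0 (real (Suc k) - h) * (1 / 2) ^ Suc k" for h k
  have a: "a k > 0" for k using m by (simp add: a_def)
  have T0: "T h k \<ge> 0" for h k using a[of k] by (simp add: T_def)
  have half: "(\<lambda>k. (1 / 2) ^ Suc k) sums (1::real)" by (rule power_half_series)
  have sT: "summable (T h)" for h
  proof (rule summable_comparison_test')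
    show "summable (\<lambda>k. r 0 * (1 + \<bar>h\<bar>) * (1 / 2) ^ Suc k)"
      using half by (intro summable_mult) (rule sums_summable)
    fix k :: nat
    have "max 0 (real (Suc k) - h) \<le> (1 + \<bar>h\<bar>) * real (Suc k)"
      by (simp add: algebra_simps max_def) (smt (verit, best) mult_nonneg_nonneg of_nat_0_le_iff)
    then have "a k * max 0 (real (Suc k) - h) \<le> a k * ((1 + \<bar>h\<bar>) * real (Suc k))"
      using a[of k] by (intro mult_left_mono) auto
    also have "\<dots> = m k * (1 + \<bar>h\<bar>)" by (simp add: a_def)
    also have "\<dots> \<le> r 0 * (1 + \<bar>h\<bar>)" using m(2)[of 0 k] by (intro mult_right_mono) auto
    finally show "norm (T h k) \<le> r 0 * (1 + \<bar>h\<bar>) * (1 / 2) ^ Suc k"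
      using T0[of h k] unfolding T_def real_norm_def abs_of_nonneg[OF T0[unfolded T_def]]
      by (intro mult_right_mono) auto
  qed
  show ?thesis
  proof (rule that[of "\<lambda>h. \<Sum>k. T h k"])
    show "convex_on UNIV (\<lambda>h. \<Sum>k. T h k)"
    proof (rule convex_onI)
      fix t x y :: real assume t: "0 < t" "t < 1"
      have "T ((1 - t) * x + t * y) k \<le> (1 - t) * T x k + t * T y k" for k
      proof -
        have "real (Suc k) - ((1 - t) * x + t * y)
            = (1 - t) * (real (Suc k) - x) + t * (real (Suc k) - y)" by (simp add: algebra_simps)
        also have "\<dots> \<le> (1 - t) * max 0 (real (Suc k) - x) + t * max 0 (real (Suc k) - y)"
          using t by (intro add_mono mult_left_mono) auto
        finally have "max 0 (real (Suc k) - ((1 - t) * x + t * y))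
            \<le> (1 - t) * max 0 (real (Suc k) - x) + t * max 0 (real (Suc k) - y)"
          using t by simp
        then have "a k * (1 / 2) ^ Suc k * max 0 (real (Suc k) - ((1 - t) * x + t * y))
            \<le> a k * (1 / 2) ^ Suc k * ((1 - t) * max 0 (real (Suc k) - x) + t * max 0 (real (Suc k) - y))"
          using a[of k] by (intro mult_left_mono) auto
        then show ?thesis unfolding T_def by (simp only: distrib_left mult_ac)
      qed
      then have "(\<Sum>k. T ((1 - t) * x + t * y) k) \<le> (\<Sum>k. (1 - t) * T x k + t * T y k)"
        by (intro suminf_le summable_add summable_mult sT)
      also have "\<dots> = (1 - t) * (\<Sum>k. T x k) + t * (\<Sum>k. T y k)"
        by (simp add: suminf_add[symmetric] suminf_mult sT summable_mult)
      finally show "(\<Sum>k. T ((1 - t) *\<^sub>R x + t *\<^sub>R y) k) \<le> (1 - t) * (\<Sum>k. T x k) + t * (\<Sum>k. T y k)"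
        by simp
    qed simp
    show "antimono (\<lambda>h. \<Sum>k. T h k)"
    proof (rule antimonoI)
      fix x y :: real assume "x \<le> y"
      then have "T y k \<le> T x k" for k
        unfolding T_def using a[of k] by (intro mult_right_mono mult_left_mono) auto
      then show "(\<Sum>k. T y k) \<le> (\<Sum>k. T x k)" by (intro suminf_le sT)
    qed
    show "(\<Sum>k. T h k) > 0" for h
    proof -
      obtain k where "h < real k" using reals_Archimedean2 by blast
      then have "T h k > 0" using a[of k] by (simp add: T_def)
      then show ?thesis using sT T0 by (intro suminf_pos2)
    qed
    show "(\<Sum>k. T (real j) k) \<le> r j" for j
    proof -
      have "T (real j) k \<le> r j * (1 / 2) ^ Suc k" for k
      proof (cases "j \<le> k")
        case True
        have "a k * max 0 (real (Suc k) - real j) \<le> a k * real (Suc k)"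
          using a[of k] by (intro mult_left_mono) auto
        also have "\<dots> = m k" by (simp add: a_def)
        also have "\<dots> \<le> r j" using m True by simp
        finally show ?thesis unfolding T_def by (intro mult_right_mono) auto
      next
        case False
        then have "max 0 (real (Suc k) - real j) = 0" by simp
        then show ?thesis using r[of j] by (simp add: T_def)
      qed
      then have "(\<Sum>k. T (real j) k) \<le> (\<Sum>k. r j * (1 / 2) ^ Suc k)"
        using half by (intro suminf_le sT summable_mult) (auto dest: sums_summable)
      also have "\<dots> = r j" using half by (simp only: suminf_mult sums_summable sums_iff mult_1_right)
      finally show ?thesis .
    qed
  qed
qed

section \<open>Normals and tangent balls\<close>

text \<open>The upward unit normal to the graph of an affine function with slope
  \<open>p\<close>.\<close>

definition unit_normal :: "'a::real_inner \<Rightarrow> 'a \<times> real" where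
  "unit_normal p = (1 / sqrt (1 + (norm p)\<^sup>2)) *\<^sub>R (- p, 1)"

lemma inner_unit_normal: "unit_normal p \<bullet> (d, \<tau>) = (\<tau> - p \<bullet> d) / sqrt (1 + (norm p)\<^sup>2)"
  by (simp add: unit_normal_def diff_divide_distrib)

lemma snd_unit_normal: "snd (unit_normal p) = 1 / sqrt (1 + (norm p)\<^sup>2)"
  by (simp add: unit_normal_def)

lemma one_le_sqrt_one_plus_square: "1 \<le> sqrt (1 + (norm p)\<^sup>2)"
  by simp

lemma norm_unit_normal [simp]: "norm (unit_normal p) = 1"
proof -
  have "norm (- p, 1::real) = sqrt (1 + (norm p)\<^sup>2)" by (simp add: norm_Pair)
  moreover have "sqrt (1 + (norm p)\<^sup>2) > 0" using one_le_sqrt_one_plus_square[of p] by linarith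
  ultimately show ?thesis unfolding unit_normal_def norm_scaleR by simp
qed

text \<open>Comparison with \<open>r\<^sup>2\<close> decides whether \<open>(d, \<tau>)\<close> lies
  in the ball of radius \<open>r\<close> that rests at the origin on the hyperplane of slope
  \<open>p\<close>.\<close>

lemma norm_diff_unit_normal:
  "(norm ((d, \<tau>) - r *\<^sub>R unit_normal p))\<^sup>2
    = (norm d)\<^sup>2 + \<tau>\<^sup>2 - 2 * r * ((\<tau> - p \<bullet> d) / sqrt (1 + (norm p)\<^sup>2)) + r\<^sup>2"
proof -
  have "(norm ((d, \<tau>) - r *\<^sub>R unit_normal p))\<^sup>2
      = (norm (d, \<tau>))\<^sup>2 - 2 * r * (unit_normal p \<bullet> (d, \<tau>)) + r\<^sup>2 * (norm (unit_normal p))\<^sup>2"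
    unfolding power2_norm_eq_inner inner_diff_left inner_diff_right inner_scaleR_left inner_scaleR_right
    by (simp add: inner_commute power2_eq_square algebra_simps)
  then show ?thesis by (simp add: inner_unit_normal norm_Pair)
qed

section \<open>Admissible balls and their union\<close>

text \<open>Inclusion in the epigraph is written pointwise over a fixed unit ball; for convex
  \<open>f\<close> this is visibly stable under convex combinations of \<open>(c, r)\<close> and
  closed in the pair.\<close>

definition inner_balls :: "('a::euclidean_space \<Rightarrow> real) \<Rightarrow> (real \<Rightarrow> real) \<Rightarrow> (('a \<times> real) \<times> real) set" where
  "inner_balls f \<rho> = {(c, r). \<rho> (snd c) \<le> r \<and> r \<le> 1 \<and>
    (\<forall>e\<in>cball 0 1. c + r *\<^sub>R e \<in> epigraph UNIV f)}"

definition ball_union :: "('a::euclidean_space \<Rightarrow> real) \<Rightarrow> (real \<Rightarrow> real) \<Rightarrow> ('a \<times> real) set" where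
  "ball_union f \<rho> = (\<Union>(c, r)\<in>inner_balls f \<rho>. cball c r)"

definition smoothing :: "('a::euclidean_space \<Rightarrow> real) \<Rightarrow> (real \<Rightarrow> real) \<Rightarrow> 'a \<Rightarrow> real" where
  "smoothing f \<rho> x = Inf {t. (x, t) \<in> ball_union f \<rho>}"

lemma ball_unionI: "(c, r) \<in> inner_balls f \<rho> \<Longrightarrow> dist c z \<le> r \<Longrightarrow> z \<in> ball_union f \<rho>"
  by (auto simp: ball_union_def intro!: bexI[of _ "(c, r)"])

lemma ball_unionE:
  assumes "z \<in> ball_union f \<rho>"
  obtains c r where "(c, r) \<in> inner_balls f \<rho>" "dist c z \<le> r"
  using assms unfolding ball_union_def by force

context
  fixes f :: "'a::euclidean_space \<Rightarrow> real" and \<rho> :: "real \<Rightarrow> real"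
  assumes f: "convex_on UNIV f" and f0: "\<And>x. f x \<ge> 0"
    and \<rho>: "convex_on UNIV \<rho>" "antimono \<rho>" and \<rho>0: "\<And>h. \<rho> h > 0" and \<rho>1: "\<rho> 0 \<le> 1"
begin

lemma inner_balls_pos: "(c, r) \<in> inner_balls f \<rho> \<Longrightarrow> r > 0"
  using \<rho>0[of "snd c"] by (simp add: inner_balls_def)

lemma continuous_on_f: "continuous_on UNIV f"
  using f by (intro convex_on_continuous) auto

lemma ball_union_subset_epigraph: "ball_union f \<rho> \<subseteq> epigraph UNIV f"
proof
  fix z assume "z \<in> ball_union f \<rho>"
  then obtain c r where cr: "(c, r) \<in> inner_balls f \<rho>" "dist c z \<le> r" by (rule ball_unionE)
  have "r > 0" using cr(1) by (rule inner_balls_pos)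
  then have "norm ((1 / r) *\<^sub>R (z - c)) \<le> 1" using cr(2) by (simp add: dist_norm norm_minus_commute)
  then have "c + r *\<^sub>R ((1 / r) *\<^sub>R (z - c)) \<in> epigraph UNIV f"
    using cr(1) unfolding inner_balls_def mem_cball_0[symmetric] by blast
  then show "z \<in> epigraph UNIV f" using \<open>r > 0\<close> by simp
qed

text \<open>Convex combinations of centres and radii stay admissible: convexity of
  \<open>\<rho>\<close> preserves the lower radius bound, convexity of the epigraph the
  inclusion.\<close>

lemma convex_ball_union: "convex (ball_union f \<rho>)"
proof (rule convexI)
  fix z z' and u v :: real
  assume z: "z \<in> ball_union f \<rho>" "z' \<in> ball_union f \<rho>" and uv: "0 \<le> u" "0 \<le> v" "u + v = 1"
  obtain c r where cr: "(c, r) \<in> inner_balls f \<rho>" "dist c z \<le> r" using z(1) by (rule ball_unionE)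
  obtain c' r' where cr': "(c', r') \<in> inner_balls f \<rho>" "dist c' z' \<le> r'" using z(2) by (rule ball_unionE)
  have "(u *\<^sub>R c + v *\<^sub>R c', u * r + v * r') \<in> inner_balls f \<rho>"
    unfolding inner_balls_def
  proof (intro CollectI case_prodI conjI ballI)
    have "\<rho> (u *\<^sub>R snd c + v *\<^sub>R snd c') \<le> u * \<rho> (snd c) + v * \<rho> (snd c')"
      using \<rho>(1) uv by (simp add: convex_on_def)
    also have "\<dots> \<le> u * r + v * r'"
      using cr cr' uv by (intro add_mono mult_left_mono) (auto simp: inner_balls_def)
    finally show "\<rho> (snd (u *\<^sub>R c + v *\<^sub>R c')) \<le> u * r + v * r'" by simp
    have "u * r + v * r' \<le> u * 1 + v * 1"
      using cr cr' uv by (intro add_mono mult_left_mono) (auto simp: inner_balls_def)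
    then show "u * r + v * r' \<le> 1" using uv by simp
    fix e :: "'a \<times> real" assume e: "e \<in> cball 0 1"
    have "u *\<^sub>R (c + r *\<^sub>R e) + v *\<^sub>R (c' + r' *\<^sub>R e) \<in> epigraph UNIV f"
      using cr cr' e uv f
      by (intro convexD[OF convex_epigraphI]) (auto simp: inner_balls_def)
    then show "u *\<^sub>R c + v *\<^sub>R c' + (u * r + v * r') *\<^sub>R e \<in> epigraph UNIV f"
      by (simp add: algebra_simps)
  qed
  moreover have "dist (u *\<^sub>R c + v *\<^sub>R c') (u *\<^sub>R z + v *\<^sub>R z') \<le> u * r + v * r'"
  proof -
    have "dist (u *\<^sub>R c + v *\<^sub>R c') (u *\<^sub>R z + v *\<^sub>R z') \<le> dist (u *\<^sub>R c) (u *\<^sub>R z) + dist (v *\<^sub>R c') (v *\<^sub>R z')"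
      by (rule dist_triangle_add)
    also have "\<dots> = u * dist c z + v * dist c' z'" 
      using uv by (simp add: dist_norm scaleR_diff_right[symmetric])
    also have "\<dots> \<le> u * r + v * r'" using cr cr' uv by (intro add_mono mult_left_mono) auto
    finally show ?thesis .
  qed
  ultimately show "u *\<^sub>R z + v *\<^sub>R z' \<in> ball_union f \<rho>" by (rule ball_unionI)
qed

lemma closed_inner_balls: "closed (inner_balls f \<rho>)"
proof -
  have "continuous_on UNIV \<rho>" using \<rho>(1) by (intro convex_on_continuous) auto
  then have 1: "continuous_on UNIV (\<lambda>w::('a \<times> real) \<times> real. \<rho> (snd (fst w)))"
    by (rule continuous_on_compose2) (auto intro!: continuous_intros)
  have 2: "continuous_on UNIV (\<lambda>w::('a \<times> real) \<times> real. f (fst (fst w + snd w *\<^sub>R e)))" for e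
    by (rule continuous_on_compose2[OF continuous_on_f]) (auto intro!: continuous_intros)
  have "inner_balls f \<rho> = {w. \<rho> (snd (fst w)) \<le> snd w} \<inter> {w. snd w \<le> 1} \<inter>
      (\<Inter>e\<in>cball 0 1. {w. f (fst (fst w + snd w *\<^sub>R e)) \<le> snd (fst w + snd w *\<^sub>R e)})"
    by (simp add: inner_balls_def epigraph_def case_prod_unfold set_eq_iff conj_assoc del: split_paired_All)
  also have "closed \<dots>"
    by (intro closed_Int closed_INT ballI closed_Collect_le 1 2 continuous_intros)
  finally show ?thesis .
qed

text \<open>Balls chosen for a convergent sequence have bounded centres and radii in
  \<open>[0, 1]\<close>; a subsequence converges to an admissible ball that contains the
  limit.\<close>

lemma closed_ball_union: "closed (ball_union f \<rho>)"
  unfolding closed_sequential_limits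
proof (intro allI impI, elim conjE)
  fix z l assume z: "\<forall>n::nat. z n \<in> ball_union f \<rho>" and lim: "z \<longlonglongrightarrow> l"
  have "\<forall>n. \<exists>w. w \<in> inner_balls f \<rho> \<and> dist (fst w) (z n) \<le> snd w"
    using z by (metis ball_unionE fst_conv snd_conv)
  then obtain w where w: "\<And>n. w n \<in> inner_balls f \<rho>" "\<And>n. dist (fst (w n)) (z n) \<le> snd (w n)"
    by metis
  obtain B where B: "\<And>n. norm (z n) \<le> B"
    using convergent_imp_bounded[OF lim] by (auto simp: bounded_iff)
  have "w n \<in> cball 0 (B + 1) \<times> {0..1}" for n
  proof -
    have s: "0 \<le> snd (w n)" "snd (w n) \<le> 1"
      using w(1)[of n] inner_balls_pos[of "fst (w n)" "snd (w n)"] by (auto simp: inner_balls_def)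
    have "norm (fst (w n)) \<le> norm (z n) + dist (fst (w n)) (z n)"
      using norm_triangle_sub[of "fst (w n)" "z n"] by (simp add: dist_norm)
    then have "norm (fst (w n)) \<le> B + 1" using B[of n] w(2)[of n] s by linarith
    then show ?thesis using s by (simp add: mem_Times_iff)
  qed
  moreover have "compact (cball (0 :: 'a \<times> real) (B + 1) \<times> {0..1::real})"
    by (intro compact_Times compact_cball) simp
  ultimately obtain k q where "strict_mono q" and k: "(w \<circ> q) \<longlonglongrightarrow> k"
    unfolding compact_def by blast
  have "k \<in> inner_balls f \<rho>"
    by (rule closed_sequentially[OF closed_inner_balls _ k]) (simp add: w(1))
  moreover have "dist (fst k) l \<le> snd k"
  proof (rule LIMSEQ_le)
    show "(\<lambda>n. dist (fst ((w \<circ> q) n)) ((z \<circ> q) n)) \<longlonglongrightarrow> dist (fst k) l"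
      by (intro tendsto_intros k LIMSEQ_subseq_LIMSEQ lim \<open>strict_mono q\<close>)
    show "(\<lambda>n. snd ((w \<circ> q) n)) \<longlonglongrightarrow> snd k" by (intro tendsto_intros k)
  qed (use w(2) in auto)
  ultimately show "l \<in> ball_union f \<rho>" by (intro ball_unionI[of "fst k" "snd k"]) auto
qed

text \<open>Lifting a ball keeps it admissible, since the epigraph is closed upward and
  \<open>\<rho>\<close> decreases with height.\<close>

lemma ball_union_upward: 
  assumes "(x, t) \<in> ball_union f \<rho>" "t \<le> t'"
  shows "(x, t') \<in> ball_union f \<rho>"
proof -
  obtain c r where cr: "(c, r) \<in> inner_balls f \<rho>" "dist c (x, t) \<le> r" using assms(1) by (rule ball_unionE)
  have "(c + (0, t' - t), r) \<in> inner_balls f \<rho>"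
    unfolding inner_balls_def
  proof (intro CollectI case_prodI conjI ballI)
    have "\<rho> (snd (c + (0, t' - t))) \<le> \<rho> (snd c)" using \<rho>(2) assms(2) by (auto intro: antimonoD)
    then show "\<rho> (snd (c + (0, t' - t))) \<le> r" using cr(1) by (auto simp: inner_balls_def)
    show "r \<le> 1" using cr(1) by (auto simp: inner_balls_def)
    fix e :: "'a \<times> real" assume "e \<in> cball 0 1"
    then have "c + r *\<^sub>R e \<in> epigraph UNIV f" using cr(1) by (auto simp: inner_balls_def)
    then show "c + (0, t' - t) + r *\<^sub>R e \<in> epigraph UNIV f" using assms(2) by (simp add: epigraph_def)
  qed
  moreover have "c + (0, t' - t) - (x, t') = c - (x, t)" by (simp add: prod_eq_iff)
  then have "dist (c + (0, t' - t)) (x, t') \<le> r" using cr(2) by (simp only: dist_norm)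
  ultimately show ?thesis by (rule ball_unionI)
qed

lemma ball_union_fibre_nonempty: "\<exists>t. (x, t) \<in> ball_union f \<rho>"
proof -
  have "compact (f ` cball x 1)"
    by (intro compact_continuous_image continuous_on_subset[OF continuous_on_f]) auto
  then obtain K where K: "\<forall>y\<in>f ` cball x 1. norm y \<le> K"
    using compact_imp_bounded bounded_iff by blast
  \<comment> \<open>A unit ball high enough to clear \<open>f\<close> on \<open>cball x 1\<close>;
    \<open>\<rho> 0 \<le> 1\<close> makes radius 1 admissible there.\<close>
  have "((x, \<bar>K\<bar> + 1), 1) \<in> inner_balls f \<rho>"
    unfolding inner_balls_def
  proof (intro CollectI case_prodI conjI ballI)
    have "\<rho> (\<bar>K\<bar> + 1) \<le> \<rho> 0" using \<rho>(2) by (auto intro: antimonoD)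
    then show "\<rho> (snd (x, \<bar>K\<bar> + 1)) \<le> 1" using \<rho>1 by simp
    fix e :: "'a \<times> real" assume "e \<in> cball 0 1"
    then have e: "norm (fst e) \<le> 1" "\<bar>snd e\<bar> \<le> 1"
      using norm_fst_le[of "fst e" "snd e"] norm_snd_le[of "snd e" "fst e"] by auto
    then have "\<bar>f (x + fst e)\<bar> \<le> K" using K by (auto simp: dist_norm)
    then show "(x, \<bar>K\<bar> + 1) + 1 *\<^sub>R e \<in> epigraph UNIV f" using e by (simp add: epigraph_def)
  qed simp
  then show ?thesis using ball_unionI[of "(x, \<bar>K\<bar> + 1)" 1 f \<rho> "(x, \<bar>K\<bar> + 1)"] by auto
qed

text \<open>Fibres are closed, so the infimum is attained; being closed upward as well, the union is
  exactly the epigraph of \<open>smoothing f \<rho>\<close>.\<close>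

lemma mem_ball_union_iff: "(x, t) \<in> ball_union f \<rho> \<longleftrightarrow> smoothing f \<rho> x \<le> t"
proof
  let ?T = "{t. (x, t) \<in> ball_union f \<rho>}"
  have bdd: "bdd_below ?T"
    using ball_union_subset_epigraph by (intro bdd_belowI[of _ "f x"]) (auto simp: epigraph_def)
  show "smoothing f \<rho> x \<le> t" if "(x, t) \<in> ball_union f \<rho>"
    unfolding smoothing_def using that bdd by (intro cInf_lower) auto
  have "closed ((\<lambda>t. (x, t)) -` ball_union f \<rho>)"
    by (intro continuous_closed_vimage closed_ball_union continuous_intros)
  then have "closed ?T" by (simp add: vimage_def)
  then have "smoothing f \<rho> x \<in> ?T"
    unfolding smoothing_def using ball_union_fibre_nonempty bdd by (intro closed_contains_Inf) auto
  then show "(x, t) \<in> ball_union f \<rho>" if "smoothing f \<rho> x \<le> t"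
    using that ball_union_upward by blast
qed

lemma convex_on_smoothing: "convex_on UNIV (smoothing f \<rho>)"
proof -
  have "epigraph UNIV (smoothing f \<rho>) = ball_union f \<rho>"
    by (auto simp: epigraph_def mem_ball_union_iff)
  then show ?thesis using convex_ball_union by (simp add: convex_epigraph[symmetric])
qed

lemma smoothing_ge: "f x \<le> smoothing f \<rho> x"
proof -
  have "(x, smoothing f \<rho> x) \<in> ball_union f \<rho>" by (simp add: mem_ball_union_iff)
  then show ?thesis using ball_union_subset_epigraph by (auto simp: epigraph_def)
qed

text \<open>The ball of radius \<open>r\<close> resting on the graph at \<open>x\<close> is
  admissible. \<open>C * (2 * r) \<le> 1\<close> makes it curve at least as much as the paraboloid,
  and \<open>r \<le> 1 / 2\<close> keeps it within horizontal distance 1 of \<open>x\<close>, where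
  the paraboloid bounds \<open>f\<close>.\<close>

lemma smoothing_eq_if_touched_above:
  assumes x: "touched_above f C x p" and r: "\<rho> (f x) \<le> r" "r \<le> 1 / 2" "C * (2 * r) \<le> 1"
  shows "smoothing f \<rho> x = f x"
proof -
  let ?s = "sqrt (1 + (norm p)\<^sup>2)"
  have "r > 0" using r(1) \<rho>0[of "f x"] by linarith
  have "((x, f x) + r *\<^sub>R unit_normal p, r) \<in> inner_balls f \<rho>"
    unfolding inner_balls_def
  proof (intro CollectI case_prodI conjI ballI)
    \<comment> \<open>The centre lies above height \<open>f x\<close>, and \<open>\<rho>\<close> is
      decreasing.\<close>
    have "\<rho> (snd ((x, f x) + r *\<^sub>R unit_normal p)) \<le> \<rho> (f x)"
      using \<open>r > 0\<close> by (intro antimonoD[OF \<rho>(2)]) (simp add: snd_unit_normal)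
    then show "\<rho> (snd ((x, f x) + r *\<^sub>R unit_normal p)) \<le> r" using r(1) by linarith
    show "r \<le> 1" using r(2) by simp
    fix e :: "'a \<times> real" assume "e \<in> cball 0 1"
    then have e: "norm e \<le> 1" by simp
    obtain d \<tau> where d\<tau>: "r *\<^sub>R unit_normal p + r *\<^sub>R e = (d, \<tau>)" by (cases "r *\<^sub>R unit_normal p + r *\<^sub>R e")
    have "norm d \<le> norm (d, \<tau>)" by (rule norm_fst_le)
    also have "\<dots> \<le> norm (r *\<^sub>R unit_normal p) + norm (r *\<^sub>R e)"
      unfolding d\<tau>[symmetric] by (rule norm_triangle_ineq)
    also have "\<dots> \<le> r + r * 1" using e \<open>r > 0\<close> by (intro add_mono) auto
    finally have d: "norm d \<le> 1" using r(2) by simp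
    have "(d, \<tau>) - r *\<^sub>R unit_normal p = r *\<^sub>R e" using d\<tau>[symmetric] by simp
    then have "norm ((d, \<tau>) - r *\<^sub>R unit_normal p) \<le> r" using e \<open>r > 0\<close> by simp
    then have "(norm ((d, \<tau>) - r *\<^sub>R unit_normal p))\<^sup>2 \<le> r\<^sup>2" by (intro power_mono) auto
    then have "(norm d)\<^sup>2 + \<tau>\<^sup>2 \<le> 2 * r * ((\<tau> - p \<bullet> d) / ?s)"
      unfolding norm_diff_unit_normal by simp
    then have *: "(norm d)\<^sup>2 \<le> 2 * r * ((\<tau> - p \<bullet> d) / ?s)" using zero_le_power2[of \<tau>] by linarith
    then have "0 \<le> 2 * r * ((\<tau> - p \<bullet> d) / ?s)" using zero_le_power2[of "norm d"] by linarith
    moreover have s: "?s > 0" using one_le_sqrt_one_plus_square[of p] by linarith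
    ultimately have pos: "0 \<le> \<tau> - p \<bullet> d"
      using \<open>r > 0\<close> by (simp only: zero_le_mult_iff zero_le_divide_iff) linarith
    have "(\<tau> - p \<bullet> d) / ?s \<le> \<tau> - p \<bullet> d"
      using mult_left_mono[OF one_le_sqrt_one_plus_square[of p] pos] s by (simp only: pos_divide_le_eq mult_1_right)
    then have "2 * r * ((\<tau> - p \<bullet> d) / ?s) \<le> 2 * r * (\<tau> - p \<bullet> d)"
      using \<open>r > 0\<close> by (intro mult_left_mono) auto
    with * have 2: "(norm d)\<^sup>2 \<le> 2 * r * (\<tau> - p \<bullet> d)" by linarith
    have "C * (norm d)\<^sup>2 \<le> \<tau> - p \<bullet> d"
    proof (cases "C \<ge> 0")
      case True
      then have "C * (norm d)\<^sup>2 \<le> C * (2 * r * (\<tau> - p \<bullet> d))" using 2 by (intro mult_left_mono)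
      also have "\<dots> = C * (2 * r) * (\<tau> - p \<bullet> d)" by simp
      also have "\<dots> \<le> 1 * (\<tau> - p \<bullet> d)" using r(3) pos by (intro mult_right_mono)
      finally show ?thesis by simp
    next
      case False
      then have "C * (norm d)\<^sup>2 \<le> 0" by (simp add: mult_nonpos_nonneg)
      then show ?thesis using pos by linarith
    qed
    moreover have "f (x + d) \<le> f x + p \<bullet> d + C * (norm d)\<^sup>2" using x d by (simp add: touched_above_def)
    ultimately have "f (x + d) \<le> f x + \<tau>" by linarith
    moreover have "(x, f x) + r *\<^sub>R unit_normal p + r *\<^sub>R e = (x + d, f x + \<tau>)"
      unfolding add.assoc d\<tau> by simp
    ultimately show "(x, f x) + r *\<^sub>R unit_normal p + r *\<^sub>R e \<in> epigraph UNIV f"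
      by (simp add: epigraph_def)
  qed
  then have "(x, f x) \<in> ball_union f \<rho>"
    by (rule ball_unionI) (use \<open>r > 0\<close> in \<open>simp add: dist_norm\<close>)
  then show ?thesis using smoothing_ge[of x] by (simp add: mem_ball_union_iff)
qed

text \<open>A ball inside the epigraph that touches its boundary lies on the normal determined by any
  supporting hyperplane, so its lower hemisphere bounds \<open>smoothing f \<rho>\<close> from above by a paraboloid.\<close>

lemma C11_loc_smoothing: "C11_loc (smoothing f \<rho>)"
proof (rule C11_loc_if_quadratic_bound[OF convex_on_smoothing])
  fix x\<^sub>0
  let ?g = "smoothing f \<rho>"
  have cont: "continuous_on UNIV ?g" using convex_on_smoothing by (intro convex_on_continuous) auto
  obtain M where "M > 0" and M: "\<And>x p. x \<in> cball x\<^sub>0 1 \<Longrightarrow> subgradient ?g x p \<Longrightarrow> norm p \<le> M"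
    using subgradient_locally_bounded[OF cont, of x\<^sub>0 1] by blast
  have "compact (?g ` cball x\<^sub>0 1)"
    by (intro compact_continuous_image continuous_on_subset[OF cont]) auto
  then obtain B where B: "\<forall>y\<in>?g ` cball x\<^sub>0 1. norm y \<le> B"
    using compact_imp_bounded bounded_iff by blast
  \<comment> \<open>Balls that touch the graph of \<open>?g\<close> over
    \<open>cball x\<^sub>0 1\<close> have centres of height at most \<open>B + 1\<close>, so their
    radii are at least \<open>r\<^sub>0\<close>.\<close>
  define r\<^sub>0 where "r\<^sub>0 = \<rho> (B + 1)"
  define s\<^sub>0 where "s\<^sub>0 = sqrt (1 + M\<^sup>2)"
  \<comment> \<open>Chosen so that \<open>(d, \<tau>)\<close>, lying
    \<open>A * (norm d)\<^sup>2\<close> above a plane of slope at most \<open>M\<close> and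
    satisfying \<open>\<bar>\<tau>\<bar> \<le> (M + 1) * norm d\<close>, belongs to every tangent
    ball of radius at least \<open>r\<^sub>0\<close>.\<close>
  define A where "A = (1 + (M + 1)\<^sup>2) * s\<^sub>0 / (2 * r\<^sub>0)"
  have r\<^sub>0: "r\<^sub>0 > 0" using \<rho>0 by (simp add: r\<^sub>0_def)
  have s\<^sub>0: "s\<^sub>0 \<ge> 1" by (simp add: s\<^sub>0_def)
  have num: "1 + (M + 1)\<^sup>2 > 0" by (simp add: add_pos_nonneg)
  have A: "A > 0" using r\<^sub>0 s\<^sub>0 num by (simp add: A_def)
  define \<delta> where "\<delta> = min 1 (1 / A)"
  have "?g (x + d) \<le> ?g x + p \<bullet> d + A * (norm d)\<^sup>2"
    if x: "x \<in> ball x\<^sub>0 \<delta>" and p: "subgradient ?g x p" and d: "norm d \<le> \<delta>" for x p d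
  proof -
    let ?s = "sqrt (1 + (norm p)\<^sup>2)" and ?z = "(x, ?g x)"
    have x1: "x \<in> cball x\<^sub>0 1" using x by (auto simp: \<delta>_def)
    have pM: "norm p \<le> M" using x1 p by (rule M)
    have s: "0 < ?s" "?s \<le> s\<^sub>0"
      using one_le_sqrt_one_plus_square[of p] pM by (linarith, auto simp: s\<^sub>0_def intro!: power_mono)
    have "?z \<in> ball_union f \<rho>" by (simp add: mem_ball_union_iff)
    then obtain c r where cr: "(c, r) \<in> inner_balls f \<rho>" "dist c ?z \<le> r" by (rule ball_unionE)
    have r: "r > 0" using cr(1) by (rule inner_balls_pos)
    have above: "?g (fst w) \<le> snd w" if "dist c w \<le> r" for w
      using ball_unionI[OF cr(1) that] mem_ball_union_iff[of "fst w" "snd w"] by simp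
    \<comment> \<open>The lowest point of the ball in the normal direction is above the supporting
      hyperplane, so \<open>c - ?z\<close> has normal component at least \<open>r\<close>; its
      length is at most \<open>r\<close>, which leaves only the normal vector itself.\<close>
    have "c - ?z = r *\<^sub>R unit_normal p"
    proof -
      let ?w = "c - r *\<^sub>R unit_normal p"
      have "?g (fst ?w) \<le> snd ?w" using r by (intro above) (simp add: dist_norm)
      moreover have "?g x + p \<bullet> (fst ?w - x) \<le> ?g (fst ?w)" using p by (rule subgradientD)
      ultimately have "0 \<le> (snd ?w - ?g x) - p \<bullet> (fst ?w - x)" by linarith
      then have "0 \<le> unit_normal p \<bullet> (fst ?w - x, snd ?w - ?g x)"
        unfolding inner_unit_normal using s by simp
      also have "(fst ?w - x, snd ?w - ?g x) = (c - ?z) - r *\<^sub>R unit_normal p"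
        by (simp add: prod_eq_iff)
      finally have "r \<le> unit_normal p \<bullet> (c - ?z)"
        by (simp add: inner_diff_right[of _ _ "r *\<^sub>R unit_normal p"] power2_norm_eq_inner[symmetric])
      then have "r * r \<le> r * (unit_normal p \<bullet> (c - ?z))" using r by (intro mult_left_mono) auto
      moreover have "(norm (c - ?z))\<^sup>2 \<le> r\<^sup>2" using cr(2) by (intro power_mono) (auto simp: dist_norm)
      moreover have "(norm ((c - ?z) - r *\<^sub>R unit_normal p))\<^sup>2
          = (norm (c - ?z))\<^sup>2 - 2 * (r * (unit_normal p \<bullet> (c - ?z))) + r\<^sup>2 * (norm (unit_normal p))\<^sup>2"
        unfolding power2_norm_eq_inner inner_diff_left[of "c - ?z"] inner_diff_right[of _ "c - ?z"]
          inner_scaleR_left inner_scaleR_right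
        by (simp add: inner_commute power2_eq_square algebra_simps)
      ultimately have "(norm ((c - ?z) - r *\<^sub>R unit_normal p))\<^sup>2 \<le> 0"
        by (simp add: power2_eq_square)
      then show ?thesis by simp
    qed
    then have c: "c = ?z + r *\<^sub>R unit_normal p" by (simp add: algebra_simps)
    have "\<bar>?g x\<bar> \<le> B" using B x1 by simp
    moreover have "r \<le> 1" using cr(1) by (simp add: inner_balls_def)
    then have "r / ?s \<le> 1" using one_le_sqrt_one_plus_square[of p] s(1) by (simp only: pos_divide_le_eq)
    ultimately have "snd c \<le> B + 1" by (simp add: c snd_unit_normal)
    then have "r\<^sub>0 \<le> \<rho> (snd c)" unfolding r\<^sub>0_def by (rule antimonoD[OF \<rho>(2)])
    then have rr: "r\<^sub>0 \<le> r" using cr(1) by (simp add: inner_balls_def)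
    define \<tau> where "\<tau> = p \<bullet> d + A * (norm d)\<^sup>2"
    have "\<bar>\<tau>\<bar> \<le> norm p * norm d + A * (norm d)\<^sup>2"
      unfolding \<tau>_def using Cauchy_Schwarz_ineq2[of p d] A
      by (intro abs_triangle_ineq[THEN order_trans] add_mono) auto
    also have "\<dots> = (norm p + A * norm d) * norm d" by (simp add: power2_eq_square algebra_simps)
    also have "\<dots> \<le> (M + 1) * norm d"
    proof (intro mult_right_mono add_mono pM)
      have "norm d \<le> 1 / A" using d by (simp add: \<delta>_def)
      then show "A * norm d \<le> 1" using A by (simp add: field_simps)
    qed simp
    finally have "\<bar>\<tau>\<bar>\<^sup>2 \<le> ((M + 1) * norm d)\<^sup>2" by (intro power_mono) auto
    then have "(norm d)\<^sup>2 + \<tau>\<^sup>2 \<le> (1 + (M + 1)\<^sup>2) * (norm d)\<^sup>2" 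
      unfolding power_mult_distrib power2_abs distrib_right[of 1] by simp
    also have "\<dots> = 2 * (r\<^sub>0 / s\<^sub>0) * (A * (norm d)\<^sup>2)" using r\<^sub>0 s\<^sub>0 by (simp add: A_def)
    also have "\<dots> \<le> 2 * (r / ?s) * (A * (norm d)\<^sup>2)"
      using A rr r r\<^sub>0 s s\<^sub>0 by (intro mult_right_mono mult_left_mono frac_le) auto
    finally have "(norm ((d, \<tau>) - r *\<^sub>R unit_normal p))\<^sup>2 \<le> r\<^sup>2"
      unfolding norm_diff_unit_normal by (simp add: \<tau>_def)
    then have "norm ((d, \<tau>) - r *\<^sub>R unit_normal p) \<le> r" using r by (simp add: power2_le_iff_abs_le)
    moreover have "(x + d, ?g x + \<tau>) - c = (d, \<tau>) - r *\<^sub>R unit_normal p"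
      by (simp add: c prod_eq_iff)
    ultimately have "dist c (x + d, ?g x + \<tau>) \<le> r"
      by (simp only: dist_norm norm_minus_commute[of c])
    from above[OF this] show ?thesis by (simp add: \<tau>_def)
  qed
  then show "\<exists>\<delta>>0. \<exists>A\<ge>0. \<forall>x\<in>ball x\<^sub>0 \<delta>. \<forall>p d. subgradient ?g x p \<longrightarrow> norm d \<le> \<delta> \<longrightarrow>
      ?g (x + d) \<le> ?g x + p \<bullet> d + A * (norm d)\<^sup>2"
    using A by (intro exI[of _ \<delta>] conjI exI[of _ A]) (auto simp: \<delta>_def)
qed

end

section \<open>Approximation\<close>

lemma convex_on_add_affine:
  fixes f l :: "'a::real_vector \<Rightarrow> real"
  assumes "convex_on UNIV f" "linear l"
  shows "convex_on UNIV (\<lambda>x. f x + l x + c)"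
proof (rule convex_onI)
  fix t :: real and x y :: 'a assume "0 < t" "t < 1"
  then have "f ((1 - t) *\<^sub>R x + t *\<^sub>R y) \<le> (1 - t) * f x + t * f y"
    using convex_onD[OF assms(1), of t x y] by simp
  moreover have "l ((1 - t) *\<^sub>R x + t *\<^sub>R y) = (1 - t) * l x + t * l y"
    using assms(2) by (simp add: linear_add linear_scale)
  ultimately show "f ((1 - t) *\<^sub>R x + t *\<^sub>R y) + l ((1 - t) *\<^sub>R x + t *\<^sub>R y) + c
      \<le> (1 - t) * (f x + l x + c) + t * (f y + l y + c)"
    by (simp add: algebra_simps)
qed simp

lemma C11_loc_add_affine:
  fixes g l :: "'a::euclidean_space \<Rightarrow> real"
  assumes "C11_loc g" "linear l"
  shows "C11_loc (\<lambda>x. g x + l x + c)"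
proof -
  obtain Dg where Dg: "\<And>x. (g has_derivative blinfun_apply (Dg x)) (at x)"
    "continuous_on UNIV Dg" "\<And>x. \<exists>r>0. \<exists>L. L-lipschitz_on (ball x r) Dg"
    using assms(1) by (auto simp: C11_loc_def)
  have l: "bounded_linear l" using assms(2) by (simp add: linear_conv_bounded_linear)
  show ?thesis
    unfolding C11_loc_def
  proof (intro exI[of _ "\<lambda>x. Dg x + Blinfun l"] conjI allI)
    fix x
    have "((\<lambda>x. g x + l x + c) has_derivative (\<lambda>h. Dg x h + l h + 0)) (at x)"
      by (intro has_derivative_add Dg has_derivative_const bounded_linear_imp_has_derivative l)
    then show "((\<lambda>x. g x + l x + c) has_derivative blinfun_apply (Dg x + Blinfun l)) (at x)"
      by (simp add: plus_blinfun.rep_eq bounded_linear_Blinfun_apply l)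
    obtain r L where "r > 0" "L-lipschitz_on (ball x r) Dg" using Dg(3) by blast
    then show "\<exists>r>0. \<exists>L. L-lipschitz_on (ball x r) (\<lambda>x. Dg x + Blinfun l)"
      by (intro exI[of _ r] exI[of _ L]) (auto simp: lipschitz_on_def)
  qed (intro continuous_intros Dg)
qed

lemma C11_approximation_nonneg:
  fixes f :: "'a::euclidean_space \<Rightarrow> real"
  assumes f: "convex_on UNIV f" and f0: "\<And>x. f x \<ge> 0"
    and coercive: "filterlim f at_top at_infinity" and "\<epsilon> > 0"
  obtains g where "convex_on UNIV g" "C11_loc g" "\<And>x. f x \<le> g x"
    "emeasure lebesgue {x. f x \<noteq> g x} < ennreal \<epsilon>"
proof -
  have "\<exists>R>0. \<forall>x. f x < real k + 1 \<longrightarrow> x \<in> cball 0 R" for k :: nat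
  proof -
    have "\<forall>\<^sub>F x in at_infinity. real k + 1 \<le> f x"
      using coercive by (simp add: filterlim_at_top)
    then obtain b where b: "\<And>x. b \<le> norm x \<Longrightarrow> real k + 1 \<le> f x"
      by (auto simp: eventually_at_infinity)
    have "norm x \<le> max 1 b" if "f x < real k + 1" for x
      using b[of x] that by (cases "b \<le> norm x") auto
    then show ?thesis by (intro exI[of _ "max 1 b"]) auto
  qed
  then obtain R where R: "\<And>k. R k > 0" "\<And>k x. f x < real k + 1 \<Longrightarrow> x \<in> cball 0 (R k)"
    by metis
  \<comment> \<open>The errors sum to \<open>\<epsilon> / 2\<close>, so the final bound is strict
    although the series is compared only weakly.\<close>
  have "\<exists>C S. C > 0 \<and> compact S \<and> (\<forall>x\<in>S. \<exists>p. touched_above f C x p) \<and>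
      measure lebesgue (cball 0 (R k) - S) < \<epsilon> / 2 * (1 / 2) ^ Suc k" for k
    using touched_above_large[OF f R(1)[of k], of "\<epsilon> / 2 * (1 / 2) ^ Suc k"] \<open>\<epsilon> > 0\<close>
    by (metis divide_pos_pos mult_pos_pos zero_less_numeral zero_less_one zero_less_power)
  then obtain C S where C: "\<And>k. C k > 0" and S: "\<And>k. compact (S k)"
    and touch: "\<And>k x. x \<in> S k \<Longrightarrow> \<exists>p. touched_above f (C k) x p"
    and meas: "\<And>k. measure lebesgue (cball 0 (R k) - S k) < \<epsilon> / 2 * (1 / 2) ^ Suc k"
    by metis
  \<comment> \<open>A radius for which \<open>smoothing_eq_if_touched_above\<close> accepts
    paraboloids of opening \<open>C k\<close>.\<close>
  define r where "r k = min (1 / 2) (1 / (2 * C k))" for k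
  have r: "r k > 0" "r k \<le> 1 / 2" "C k * (2 * r k) \<le> 1" for k
    using C[of k] by (auto simp: r_def min_def field_simps)
  obtain \<rho> :: "real \<Rightarrow> real" where \<rho>: "convex_on UNIV \<rho>" "antimono \<rho>" "\<And>h. \<rho> h > 0"
      and \<rho>r: "\<And>k. \<rho> (real k) \<le> r k"
    using positive_convex_minorant[of r, OF r(1)] by blast
  have "\<rho> 0 \<le> 1" using \<rho>r[of 0] r(2)[of 0] by simp
  note facts = f f0 \<rho> this
  let ?g = "smoothing f \<rho>"
  have "{x. f x \<noteq> ?g x} \<subseteq> (\<Union>k. cball 0 (R k) - S k)"
  proof
    \<comment> \<open>The index \<open>k\<close> of the slab containing \<open>x\<close> is a
      natural number because \<open>f x\<close> is nonnegative.\<close>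
    fix x assume x: "x \<in> {x. f x \<noteq> ?g x}"
    define k where "k = nat \<lfloor>f x\<rfloor>"
    have k: "real k \<le> f x" "f x < real k + 1" using f0[of x] by (auto simp: k_def)
    have "x \<notin> S k"
    proof
      assume "x \<in> S k"
      then obtain p where "touched_above f (C k) x p" using touch by blast
      moreover have "\<rho> (f x) \<le> \<rho> (real k)" using k(1) by (rule antimonoD[OF \<rho>(2)])
      then have "\<rho> (f x) \<le> r k" using \<rho>r[of k] by linarith
      ultimately have "?g x = f x" by (rule smoothing_eq_if_touched_above[OF facts _ _ r(2,3)])
      then show False using x by simp
    qed
    then show "x \<in> (\<Union>k. cball 0 (R k) - S k)" using R(2)[OF k(2)] by blast
  qed
  then have "emeasure lebesgue {x. f x \<noteq> ?g x} \<le> emeasure lebesgue (\<Union>k. cball 0 (R k) - S k)"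
    using S by (intro emeasure_mono sets.countable_UN) (auto intro!: sets.Diff simp: compact_imp_closed)
  also have "\<dots> \<le> (\<Sum>k. emeasure lebesgue (cball 0 (R k) - S k))"
    using S by (intro emeasure_subadditive_countably) (auto intro!: sets.Diff simp: compact_imp_closed)
  also have "\<dots> \<le> (\<Sum>k. ennreal (\<epsilon> / 2 * (1 / 2) ^ Suc k))"
  proof (intro suminf_le)
    fix k
    have "cball 0 (R k) - S k \<in> lmeasurable"
      using S[of k] by (intro fmeasurable.Diff) (auto simp: lmeasurable_compact)
    then show "emeasure lebesgue (cball 0 (R k) - S k) \<le> ennreal (\<epsilon> / 2 * (1 / 2) ^ Suc k)"
      using meas[of k] by (simp add: emeasure_eq_measure2 ennreal_leI)
  qed auto
  also have "\<dots> = ennreal (\<epsilon> / 2 * 1)"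
    using \<open>\<epsilon> > 0\<close> by (intro suminf_ennreal_eq sums_mult power_half_series) auto
  also have "\<dots> < ennreal \<epsilon>" using \<open>\<epsilon> > 0\<close> by (simp add: ennreal_less_iff)
  finally have "emeasure lebesgue {x. f x \<noteq> ?g x} < ennreal \<epsilon>" .
  then show ?thesis
    using convex_on_smoothing[OF facts] C11_loc_smoothing[OF facts] smoothing_ge[OF facts]
    by (intro that)
qed

lemma C11_approximation:
  fixes f :: "'a::euclidean_space \<Rightarrow> real"
  assumes f: "convex_on UNIV f" and "essentially_coercive f" and "\<epsilon> > 0"
  obtains g where "convex_on UNIV g" "C11_loc g" "\<And>x. f x \<le> g x"
    "emeasure lebesgue {x. f x \<noteq> g x} < ennreal \<epsilon>"
proof -
  obtain l where l: "linear l" and lim: "filterlim (\<lambda>x. f x - l x) at_top at_infinity"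
    using assms(2) by (auto simp: essentially_coercive_def)
  have l': "linear (\<lambda>x. - l x)" using l by (rule linear_compose_neg)
  have conv: "convex_on UNIV (\<lambda>x. f x - l x + c)" for c
    using convex_on_add_affine[OF f l', of c] by simp
  have cont: "continuous_on UNIV (\<lambda>x. f x - l x)"
    using conv[of 0] by (intro convex_on_continuous) auto
  have "\<forall>\<^sub>F x in at_infinity. 0 \<le> f x - l x" using lim by (simp only: filterlim_at_top)
  then obtain b where b: "\<And>x. b \<le> norm x \<Longrightarrow> 0 \<le> f x - l x"
    by (auto simp: eventually_at_infinity)
  have "compact ((\<lambda>x. f x - l x) ` cball 0 b)"
    by (intro compact_continuous_image continuous_on_subset[OF cont]) auto
  then obtain K where K: "\<forall>y\<in>(\<lambda>x. f x - l x) ` cball 0 b. norm y \<le> K"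
    using compact_imp_bounded bounded_iff by blast
  \<comment> \<open>Outside the ball of radius \<open>b\<close> the difference is nonnegative,
    inside it is at least \<open>- \<bar>K\<bar>\<close>; the shift makes it nonnegative
    everywhere.\<close>
  define f\<^sub>0 where "f\<^sub>0 = (\<lambda>x. f x - l x + \<bar>K\<bar>)"
  have "f\<^sub>0 x \<ge> 0" for x
  proof (cases "b \<le> norm x")
    case True
    then show ?thesis using b[of x] by (simp add: f\<^sub>0_def)
  next
    case False
    then have "\<bar>f x - l x\<bar> \<le> K" using K by simp
    then show ?thesis by (simp add: f\<^sub>0_def)
  qed
  moreover have "filterlim f\<^sub>0 at_top at_infinity"
    using lim by (rule filterlim_at_top_mono) (simp add: f\<^sub>0_def)
  moreover have "convex_on UNIV f\<^sub>0" unfolding f\<^sub>0_def by (rule conv)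
  ultimately obtain g where g: "convex_on UNIV g" "C11_loc g" "\<And>x. f\<^sub>0 x \<le> g x"
    "emeasure lebesgue {x. f\<^sub>0 x \<noteq> g x} < ennreal \<epsilon>"
    using C11_approximation_nonneg[of f\<^sub>0 \<epsilon>] \<open>\<epsilon> > 0\<close> by blast
  show ?thesis
  proof (rule that)
    show "convex_on UNIV (\<lambda>x. g x + l x + (- \<bar>K\<bar>))" using g(1) l by (rule convex_on_add_affine)
    show "C11_loc (\<lambda>x. g x + l x + (- \<bar>K\<bar>))" using g(2) l by (rule C11_loc_add_affine)
    show "f x \<le> g x + l x + (- \<bar>K\<bar>)" for x using g(3)[of x] by (simp add: f\<^sub>0_def)
    have "{x. f x \<noteq> g x + l x + (- \<bar>K\<bar>)} = {x. f\<^sub>0 x \<noteq> g x}" by (auto simp: f\<^sub>0_def)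
    then show "emeasure lebesgue {x. f x \<noteq> g x + l x + (- \<bar>K\<bar>)} < ennreal \<epsilon>" using g(4) by simp
  qed
qed

theorem theorem1p5:
  fixes f :: "real ^ 'n \<Rightarrow> real"
  assumes "convex_on UNIV f"
    and "\<not> C11_loc f"
  shows "((\<forall>\<epsilon>>0. \<exists>g. convex_on UNIV g \<and> C11_loc g \<and>
              emeasure lebesgue {x. f x \<noteq> g x} < ennreal \<epsilon>)
          \<longleftrightarrow> essentially_coercive f)
       \<and> (essentially_coercive f \<longrightarrow>
           (\<forall>\<epsilon>>0. \<exists>g. convex_on UNIV g \<and> C11_loc g \<and>
              emeasure lebesgue {x. f x \<noteq> g x} < ennreal \<epsilon> \<and> (\<forall>x. g x \<ge> f x)))"
proof -
  have "\<exists>g. convex_on UNIV g \<and> C11_loc g \<and>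
      emeasure lebesgue {x. f x \<noteq> g x} < ennreal \<epsilon> \<and> (\<forall>x. g x \<ge> f x)"
    if "essentially_coercive f" "\<epsilon> > 0" for \<epsilon>
    using C11_approximation[OF assms(1) that] by blast
  moreover have "essentially_coercive f"
    if approx: "\<forall>\<epsilon>>0. \<exists>g. convex_on UNIV g \<and> C11_loc g \<and>
      emeasure lebesgue {x. f x \<noteq> g x} < ennreal \<epsilon>"
  proof (rule ccontr)
    assume "\<not> essentially_coercive f"
    then obtain e a where e: "e \<noteq> 0" "\<And>x t. f (x + t *\<^sub>R e) = f x + t * a"
      using not_essentially_coercive_imp_affine_direction[OF assms(1)] by blast
    \<comment> \<open>A single approximation with an exceptional set of finite measure already
      forces \<open>f = g\<close>, so \<open>\<epsilon> = 1\<close> is taken.\<close>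
    obtain g where g: "convex_on UNIV g" "C11_loc g"
      and fin: "emeasure lebesgue {x. f x \<noteq> g x} < ennreal 1"
      using approx zero_less_one by blast
    have "emeasure lebesgue {x. f x \<noteq> g x} < \<infinity>" using fin by (rule less_trans) simp
    moreover have "continuous_on UNIV f" using assms(1) by (intro convex_on_continuous) auto
    ultimately have "f = g" using g(1) e by (intro eq_if_affine_direction)
    then show False using g(2) assms(2) by simp
  qed
  ultimately show ?thesis by blast
qed

end
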